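(* Let $p\in(0,1)$ be a constant and let $G=G_p\in\mathcal{G}_{n,p}$ be a random graph. Let $Gut(G)$ be the Gutman matrix of $G$, with $(i,j)$-entry $d_id_jD(i,j)$. Then $$\mathscr{E}(Gut(G))=\Big(\frac{8}{3\pi}p^{2}\sqrt{p(1-p)}+o(1)\Big)n^{7/2}\quad\text{a.s.}$$
   Context: $d_i$ is the degree of vertex $i$ and $D(i,j)$ is the distance between vertices $i$ and $j$ in $G$ (so $D(i,i)=0$). The energy of a real symmetric matrix $M$ with eigenvalues $\lambda_1,\dots,\lambda_n$ is $\mathscr{E}(M)=\sum_{i=1}^n|\lambda_i|$. $\mathcal{G}_{n,p}$ is the Erdős–Rényi random graph model on $n$ vertices, each edge chosen independently with probability $p$. "a.s." means with probability tending to $1$ as $n\to\infty$; the $o(1)$ term is bounded in absolute value by a deterministic sequence tending to $0$ with probability tending to $1$. (With probability tending to $1$ the graph is connected with diameter $2$, so the convention for distances in disconnected graphs is irrelevant.) *)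

theory Defs
  imports "HOL-Probability.Product_PMF" "Jordan_Normal_Form.Char_Poly"
begin

text \<open>
  A simple graph on the vertex set \<open>{0..<n}\<close> is given by its edge set, a set of
  two-element subsets of \<open>{0..<n}\<close>.
\<close>

definition all_edges :: "nat \<Rightarrow> nat set set" where
  "all_edges n = {e. e \<subseteq> {0..<n} \<and> card e = 2}"

definition degree_of :: "nat set set \<Rightarrow> nat \<Rightarrow> nat" where
  "degree_of E i = card {j. {i, j} \<in> E}"

text \<open>
  A pair of vertices lies in the \<open>k\<close>-th relational power of the adjacency relation iff the
  vertices are joined by a walk of length \<open>k\<close>. The value for vertices in different
  components is a convention: it is set to \<open>0\<close>.
\<close>

definition adj_rel :: "nat set set \<Rightarrow> (nat \<times> nat) set" where
  "adj_rel E = {(u, v). {u, v} \<in> E}"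

definition graph_dist :: "nat set set \<Rightarrow> nat \<Rightarrow> nat \<Rightarrow> nat" where
  "graph_dist E i j =
    (if (i, j) \<in> (adj_rel E)\<^sup>* then (LEAST k. (i, j) \<in> adj_rel E ^^ k) else 0)"

definition gutman_mat :: "nat \<Rightarrow> nat set set \<Rightarrow> real mat" where
  "gutman_mat n E = mat n n (\<lambda>(i, j).
    real (degree_of E i) * real (degree_of E j) * real (graph_dist E i j))"

text \<open>
  \<^const>\<open>proots\<close> is the multiset of roots, so eigenvalues are counted with algebraic
  multiplicity. The notion is meant for real symmetric matrices, whose characteristic
  polynomial splits over the reals.
\<close>

definition energy :: "real mat \<Rightarrow> real" where
  "energy M = (\<Sum>x\<in>#proots (char_poly M). \<bar>x\<bar>)"

definition gnp :: "nat \<Rightarrow> real \<Rightarrow> nat set set pmf" where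
  "gnp n p = map_pmf (\<lambda>X. {e \<in> all_edges n. X e})
    (Pi_pmf (all_edges n) False (\<lambda>_. bernoulli_pmf p))"

end

theory Submission
  imports Defs "Jordan_Normal_Form.Schur_Decomposition" "Jordan_Normal_Form.Spectral_Radius"
    "HOL-Real_Asymp.Real_Asymp"
begin

text \<open>
  With probability tending to \<open>1\<close> any two vertices have a common neighbour, so the distance matrix
  is \<open>2(J - I) - A\<close>. With the centred adjacency matrix \<open>W = A - p(J - I)\<close> the Gutman matrix
  has entries \<open>d\<^sub>i d\<^sub>j ((2 - p) - (2 - p) \<delta>\<^sub>i\<^sub>j - W\<^sub>i\<^sub>j)\<close>. All degrees are close to \<open>np\<close>,
  so up to a rank one matrix, a diagonal matrix and a matrix of small Frobenius norm this is
  \<open>-(np)\<^sup>2 W\<close>. The energy is the trace norm, hence it changes by \<open>O(n\<^sup>3)\<close> in expectation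
  (\<open>mat_energy_perturbation\<close>, \<open>gutman_energy_perturbation\<close>), which is negligible against
  \<open>n\<^sup>7\<^sup>/\<^sup>2\<close>.

  It remains to show that the energy of \<open>W\<close> is \<open>(8/(3\<pi>) \<surd>(p(1-p)) + o(1)) n\<^sup>3\<^sup>/\<^sup>2\<close>, which is the
  semicircle law integrated against \<open>\<bar>x\<bar>\<close>. Instead of moments the proof uses the
  resolvent \<open>R = (W/\<surd>n - it)\<^sup>-\<^sup>1\<close> at points of the imaginary axis, because
  \<open>\<bar>x\<bar> = 2/\<pi> \<integral>\<^sub>0\<^sup>\<infinity> x\<^sup>2/(x\<^sup>2 + t\<^sup>2) dt\<close> expresses the energy
  by the imaginary part of the normalised trace \<open>m(it)\<close> of \<open>R\<close>.

  Write \<open>v = p(1-p)\<close>. For a Bernoulli variable with parameter \<open>p\<close>,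
  centring and integrating by parts is exact: the expectation of
  \<open>(X - p) f(X)\<close> is \<open>v\<close> times \<open>f(1) - f(0)\<close>. Applied to the trace of \<open>(W/\<surd>n) R = I + it R\<close>, with the
  resolvent identity for the differences, this gives \<open>1 + it E m + v E m\<^sup>2 = O(n\<^sup>-\<^sup>1\<^sup>/\<^sup>2)\<close>
  (\<open>loop_equation\<close>). Flipping one edge changes \<open>m\<close> by
  \<open>O(n\<^sup>-\<^sup>3\<^sup>/\<^sup>2)\<close> and there are at most \<open>n\<^sup>2\<close> edges, so the variance of \<open>m\<close> is \<open>O(1/n)\<close> by the
  Efron--Stein inequality. Therefore \<open>E m\<close> nearly solves
  \<open>1 + itz + vz\<^sup>2 = 0\<close>, whose only root in the upper half plane is \<open>is\<close> with
  \<open>s = (\<surd>(t\<^sup>2 + 4v) - t)/(2v)\<close> (\<open>Im_stieltjes_converges\<close>). Dominated convergence in \<open>t\<close> and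
  \<open>\<integral>\<^sub>0\<^sup>\<infinity> (1 - ts) dt = 4/3 \<surd>v\<close> finish the computation (\<open>wigner_energy_limit\<close>).
\<close>

section \<open>Orthogonal diagonalisation of real symmetric matrices\<close>

text \<open>
  The complexified matrix has an eigenvalue by the fundamental theorem of algebra. The Hermitian
  form at an eigenvector forces it to be real, and a real root of the characteristic polynomial
  has a real eigenvector.
\<close>

lemma real_symmetric_eigenvector:
  fixes A :: "real mat"
  assumes A: "A \<in> carrier_mat n n" and sym: "A\<^sup>T = A" and n: "n \<noteq> 0"
  obtains l v where "v \<in> carrier_vec n" "v \<noteq> 0\<^sub>v n" "A *\<^sub>v v = l \<cdot>\<^sub>v v"
proof -
  let ?C = "map_mat of_real A :: complex mat"
  have C: "?C \<in> carrier_mat n n" using A by auto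
  from spectrum_non_empty[OF C] n obtain z where z: "eigenvalue ?C z"
    unfolding spectrum_def by auto
  then obtain v where v: "v \<in> carrier_vec n" "v \<noteq> 0\<^sub>v n" "?C *\<^sub>v v = z \<cdot>\<^sub>v v"
    using C unfolding eigenvalue_def eigenvector_def by auto
  have ent: "A $$ (i, j) = A $$ (j, i)" if "i < n" "j < n" for i j
    using that A sym by (metis carrier_matD index_transpose_mat(1))
  have row: "(\<Sum>j<n. of_real (A $$ (i, j)) * v $ j) = z * v $ i" if "i < n" for i
  proof -
    have "(?C *\<^sub>v v) $ i = (z \<cdot>\<^sub>v v) $ i" using v(3) by simp
    then show ?thesis using that A v(1)
      by (simp add: scalar_prod_def lessThan_atLeast0)
  qed
  define q where "q = (\<Sum>i<n. \<Sum>j<n. cnj (v $ i) * of_real (A $$ (i, j)) * v $ j)"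
  have "cnj q = (\<Sum>i<n. \<Sum>j<n. v $ i * of_real (A $$ (i, j)) * cnj (v $ j))"
    unfolding q_def by simp
  also have "\<dots> = (\<Sum>j<n. \<Sum>i<n. v $ i * of_real (A $$ (i, j)) * cnj (v $ j))"
    by (rule sum.swap)
  also have "\<dots> = q" unfolding q_def
    by (intro sum.cong refl) (simp add: ent mult_ac)
  finally have q1: "cnj q = q" .
  have q2: "q = z * of_real (\<Sum>i<n. (cmod (v $ i))\<^sup>2)"
  proof -
    have "q = (\<Sum>i<n. cnj (v $ i) * (\<Sum>j<n. of_real (A $$ (i, j)) * v $ j))"
      unfolding q_def by (simp add: sum_distrib_left mult.assoc)
    also have "\<dots> = (\<Sum>i<n. cnj (v $ i) * (z * v $ i))"
      by (intro sum.cong refl) (simp add: row)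
    also have "\<dots> = (\<Sum>i<n. z * of_real ((cmod (v $ i))\<^sup>2))"
      by (intro sum.cong refl) (simp add: complex_norm_square mult_ac del: of_real_power)
    finally show ?thesis by (simp add: sum_distrib_left)
  qed
  have pos: "(\<Sum>i<n. (cmod (v $ i))\<^sup>2) \<noteq> 0"
  proof
    assume "(\<Sum>i<n. (cmod (v $ i))\<^sup>2) = 0"
    then have "\<forall>i<n. v $ i = 0" by (subst (asm) sum_nonneg_eq_0_iff) auto
    then have "v = 0\<^sub>v n" using v(1) by (intro eq_vecI) auto
    with v(2) show False by simp
  qed
  have "cnj z = z"
  proof -
    have "cnj z = z" if "cnj q = q" "q = z * of_real r" "r \<noteq> 0" for r
      using that by simp
    then show ?thesis using q1 q2 pos by blast
  qed
  then obtain l where l: "z = of_real l"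
    by (metis Reals_cnj_iff Reals_cases)
  have "poly (char_poly ?C) (of_real l) = 0"
    using z eigenvalue_root_char_poly[OF C] l by simp
  then have "poly (char_poly A) l = 0"
    unfolding of_real_hom.char_poly_hom[OF A] by simp
  then have "eigenvalue A l" using eigenvalue_root_char_poly[OF A] by simp
  then show ?thesis using that A unfolding eigenvalue_def eigenvector_def by auto
qed

text \<open>
  Gram--Schmidt keeps the direction of the first vector, so an eigenvector can be split off by an
  orthogonal change of basis.
\<close>

lemma orthogonal_matrix_with_first_column:
  fixes v :: "real vec"
  assumes v: "v \<in> carrier_vec n" "v \<noteq> 0\<^sub>v n" and n: "n \<noteq> 0"
  obtains W c where "W \<in> carrier_mat n n" "W\<^sup>T * W = 1\<^sub>m n" "col W 0 = c \<cdot>\<^sub>v v"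
proof -
  interpret cof_vec_space n "TYPE(real)" .
  define b where "b = basis_completion v"
  define ws where "ws = gram_schmidt n b"
  from basis_completion[OF v, folded b_def]
  have span_b: "span (set b) = carrier_vec n" and dist_b: "distinct b" 
    and indep: "\<not> lin_dep (set b)" and b: "set b \<subseteq> carrier_vec n" and hdb: "hd b = v" 
    and len_b: "length b = n" by auto
  from hdb len_b n obtain vs where bv: "b = v # vs" by (cases b, auto)
  from gram_schmidt_result[OF b dist_b indep refl, folded ws_def]
  have ws: "set ws \<subseteq> carrier_vec n" "corthogonal ws" "length ws = n" 
    by (auto simp: len_b)
  from gram_schmidt_hd[OF v(1), of vs, folded bv] have hdws: "hd ws = v" unfolding ws_def .
  let ?c = "\<lambda>w :: real vec. 1 / sqrt (w \<bullet> w)"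
  define W where "W = mat_of_cols n (map (\<lambda>w. ?c w \<cdot>\<^sub>v w) ws)"
  have W: "W \<in> carrier_mat n n" unfolding W_def using ws by (auto simp: mat_of_cols_def)
  have wsi: "ws ! i \<in> carrier_vec n" if "i < n" for i using ws that by (metis nth_mem subsetD)
  have colW: "col W i = ?c (ws ! i) \<cdot>\<^sub>v ws ! i" if "i < n" for i
    unfolding W_def using ws that wsi by (subst col_mat_of_cols) auto
  have conj: "conjugate w = w" for w :: "real vec" by (intro eq_vecI) auto
  have "W\<^sup>T * W = 1\<^sub>m n"
  proof (rule eq_matI)
    fix i j assume "i < dim_row (1\<^sub>m n :: real mat)" "j < dim_col (1\<^sub>m n :: real mat)"
    then have ij: "i < n" "j < n" by auto
    have "(W\<^sup>T * W) $$ (i, j) = col W i \<bullet> col W j" using ij W by simp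
    also have "\<dots> = ?c (ws ! i) * ?c (ws ! j) * (ws ! i \<bullet> ws ! j)"
      using colW ij wsi[OF ij(1)] wsi[OF ij(2)] by simp
    also have "\<dots> = (if i = j then 1 else 0)"
    proof (cases "i = j")
      case True
      have "ws ! i \<bullet> ws ! i \<noteq> 0" using corthogonalD[OF ws(2), of i i] ij ws(3) conj by auto
      moreover have "ws ! i \<bullet> ws ! i \<ge> 0" by (simp add: scalar_prod_def sum_nonneg)
      ultimately show ?thesis using True by (simp add: field_simps)
    next
      case False
      then show ?thesis using corthogonalD[OF ws(2), of i j] ij ws(3) conj by auto
    qed
    finally show "(W\<^sup>T * W) $$ (i, j) = 1\<^sub>m n $$ (i, j)" using ij by simp
  qed (use W in auto)
  moreover have "col W 0 = ?c v \<cdot>\<^sub>v v" using colW[of 0] n hdws ws(3)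
    by (metis hd_conv_nth length_0_conv not_gr_zero)
  ultimately show ?thesis using that W by blast
qed

text \<open>
  The reassociations are stated for variables, because rewriting with associativity becomes
  unmanageable on the block matrices to which they are applied.
\<close>

lemma mat_mult_regroup:
  assumes "W \<in> carrier_mat n n" "Q \<in> carrier_mat n n" "D \<in> carrier_mat n n"
    "Q' \<in> carrier_mat n n" "W' \<in> carrier_mat n n"
  shows "W * (Q * D * Q') * W' = W * Q * D * (Q' * W')"
  using assms by (simp add: assoc_mult_mat[of _ n n _ n _ n] mult_carrier_mat[of _ n n _ n])

lemma mat_mult_regroup':
  assumes "W \<in> carrier_mat n n" "Q \<in> carrier_mat n n" "Q' \<in> carrier_mat n n" "W' \<in> carrier_mat n n"
  shows "Q' * W' * (W * Q) = Q' * (W' * W) * Q"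
  using assms by (simp add: assoc_mult_mat[of _ n n _ n _ n] mult_carrier_mat[of _ n n _ n])

text \<open>
  Induction on the dimension: in an orthonormal basis that starts with an eigenvector, symmetry
  makes the matrix block diagonal with a block of size one.
\<close>

theorem real_spectral_theorem:
  fixes A :: "real mat"
  assumes "A \<in> carrier_mat n n" "A\<^sup>T = A"
  shows "\<exists>U l. U \<in> carrier_mat n n \<and> U\<^sup>T * U = 1\<^sub>m n \<and> A = U * mat_diag n l * U\<^sup>T"
  using assms
proof (induction n arbitrary: A)
  case 0
  then show ?case by (intro exI[of _ "1\<^sub>m 0"] exI[of _ "\<lambda>_. 0"] conjI eq_matI) auto
next
  case (Suc m)
  let ?n = "Suc m"
  note A = Suc.prems(1)
  obtain l v where v: "v \<in> carrier_vec ?n" "v \<noteq> 0\<^sub>v ?n" "A *\<^sub>v v = l \<cdot>\<^sub>v v"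
    using real_symmetric_eigenvector[OF Suc.prems] by blast
  obtain W c where W: "W \<in> carrier_mat ?n ?n" "W\<^sup>T * W = 1\<^sub>m ?n" "col W 0 = c \<cdot>\<^sub>v v"
    using orthogonal_matrix_with_first_column[OF v(1,2)] by auto
  have WT: "W\<^sup>T \<in> carrier_mat ?n ?n" using W by auto
  have WW: "W * W\<^sup>T = 1\<^sub>m ?n" using mat_mult_left_right_inverse[OF WT W(1) W(2)] .
  define B where "B = W\<^sup>T * A * W"
  have B: "B \<in> carrier_mat ?n ?n" using A W by (auto simp: B_def)
  have BT: "B\<^sup>T = B" unfolding B_def using A W WT Suc.prems(2)
    by (simp add: transpose_mult[of _ ?n ?n _ ?n] assoc_mult_mat[of _ ?n ?n _ ?n _ ?n])
  have ABW: "A = W * B * W\<^sup>T"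
  proof -
    have "W * B * W\<^sup>T = (W * W\<^sup>T) * A * (W * W\<^sup>T)" unfolding B_def using A W(1) WT
      by (simp add: assoc_mult_mat[of _ ?n ?n _ ?n _ ?n] mult_carrier_mat[of _ ?n ?n _ ?n])
    then show ?thesis using A by (simp add: WW)
  qed
  have AW0: "A *\<^sub>v col W 0 = l \<cdot>\<^sub>v col W 0"
    using v A W(3) by (auto simp: mult_mat_vec smult_smult_assoc mult.commute)
  have B0: "B $$ (i, 0) = (if i = 0 then l else 0)" if i: "i < ?n" for i
  proof -
    have "B = W\<^sup>T * (A * W)" unfolding B_def using A W WT by (simp add: assoc_mult_mat[of _ ?n ?n _ ?n _ ?n])
    then have "B $$ (i, 0) = col W i \<bullet> (A *\<^sub>v col W 0)"
      using i W(1) A by (simp add: mult_mat_vec_def)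
    also have "\<dots> = l * (W\<^sup>T * W) $$ (i, 0)" using i W(1) by (simp add: AW0)
    finally show ?thesis using i by (simp add: W(2))
  qed
  define C where "C = mat m m (\<lambda>(i, j). B $$ (Suc i, Suc j))"
  have C: "C \<in> carrier_mat m m" by (simp add: C_def)
  have Bs: "B $$ (i, j) = B $$ (j, i)" if "i < ?n" "j < ?n" for i j
    using that B BT by (metis carrier_matD index_transpose_mat(1))
  have "C\<^sup>T = C" unfolding C_def by (rule eq_matI) (auto intro: Bs)
  from Suc.IH[OF C this] obtain P k where P: "P \<in> carrier_mat m m" "P\<^sup>T * P = 1\<^sub>m m"
    "C = P * mat_diag m k * P\<^sup>T" by auto
  let ?bl = "\<lambda>x Y. four_block_mat (mat 1 1 (\<lambda>_. x :: real)) (0\<^sub>m 1 m) (0\<^sub>m m 1) Y"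
  have blT: "(?bl x Y)\<^sup>T = ?bl x Y\<^sup>T" if "Y \<in> carrier_mat m m" for x Y
    using that by (intro eq_matI) auto
  have blM: "?bl x Y * ?bl y Z = ?bl (x * y) (Y * Z)"
    if YZ: "Y \<in> carrier_mat m m" "Z \<in> carrier_mat m m" for x y Y Z
  proof -
    have "mat 1 1 (\<lambda>_. x) * mat 1 1 (\<lambda>_. y) = mat 1 1 (\<lambda>_. x * y)"
      by (rule eq_matI) (auto simp: scalar_prod_def)
    then show ?thesis using YZ
      by (subst mult_four_block_mat[of _ 1 1 _ m _ m _ _ 1 _ m]) (auto intro!: arg_cong2[where f = "\<lambda>a b. four_block_mat a _ _ b"])
  qed
  have BC: "B = ?bl l C"
  proof (rule eq_matI)
    fix i j assume "i < dim_row (?bl l C)" "j < dim_col (?bl l C)"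
    then have ij: "i < ?n" "j < ?n" by (auto simp: C_def)
    then show "B $$ (i, j) = ?bl l C $$ (i, j)" using B0[OF ij(1)] B0[OF ij(2)] Bs[OF ij]
      by (cases i; cases j) (auto simp: C_def)
  qed (use B in \<open>auto simp: C_def\<close>)
  let ?Q = "?bl 1 P" and ?k = "\<lambda>i. case i of 0 \<Rightarrow> l | Suc i \<Rightarrow> k i"
  have Q: "?Q \<in> carrier_mat ?n ?n" using P by (metis four_block_carrier_mat mat_carrier plus_1_eq_Suc)
  have "?Q\<^sup>T * ?Q = ?bl 1 (1\<^sub>m m)" using P by (simp only: blT blM transpose_carrier_mat) simp
  also have "\<dots> = 1\<^sub>m ?n" by (rule eq_matI) auto
  finally have QQ: "?Q\<^sup>T * ?Q = 1\<^sub>m ?n" .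
  have D: "mat_diag ?n ?k = ?bl l (mat_diag m k)"
    by (rule eq_matI) (auto simp: mat_diag_def split: nat.splits)
  have mk: "mat_diag m k \<in> carrier_mat m m" by (simp add: mat_diag_def)
  have Dk: "mat_diag ?n ?k \<in> carrier_mat ?n ?n" by (simp add: mat_diag_def)
  have BQ: "B = ?Q * mat_diag ?n ?k * ?Q\<^sup>T" unfolding BC P(3) D using P mk
    by (simp only: blT blM transpose_carrier_mat mult_carrier_mat[of _ m m _ m]) simp
  have QT: "?Q\<^sup>T \<in> carrier_mat ?n ?n" using Q by (simp only: transpose_carrier_mat)
  let ?U = "W * ?Q"
  have U: "?U \<in> carrier_mat ?n ?n" using W(1) Q by (rule mult_carrier_mat)
  have UT: "?U\<^sup>T = ?Q\<^sup>T * W\<^sup>T" by (rule transpose_mult[OF W(1) Q])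
  have "?U\<^sup>T * ?U = ?Q\<^sup>T * (W\<^sup>T * W) * ?Q" unfolding UT by (rule mat_mult_regroup'[OF W(1) Q QT WT])
  also have "\<dots> = 1\<^sub>m ?n" unfolding W(2) right_mult_one_mat[OF QT] by (rule QQ)
  finally have UU: "?U\<^sup>T * ?U = 1\<^sub>m ?n" .
  have "A = ?U * mat_diag ?n ?k * ?U\<^sup>T" unfolding UT ABW BQ
    by (rule mat_mult_regroup[OF W(1) Q Dk QT WT])
  with U UU show ?case by blast
qed

text \<open>
  From here on matrices are functions on indices, of which only those below the dimension matter;
  this avoids carrier conditions in the summations.
\<close>

definition orthonormal :: "nat \<Rightarrow> (nat \<Rightarrow> nat \<Rightarrow> real) \<Rightarrow> bool" where
  "orthonormal n u \<longleftrightarrow>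
    (\<forall>k<n. \<forall>k'<n. (\<Sum>i<n. u k i * u k' i) = of_bool (k = k')) \<and>
    (\<forall>i<n. \<forall>j<n. (\<Sum>k<n. u k i * u k j) = of_bool (i = j))"

definition mat_energy :: "nat \<Rightarrow> (nat \<Rightarrow> nat \<Rightarrow> real) \<Rightarrow> real" where
  "mat_energy n M = energy (mat n n (\<lambda>(i, j). M i j))"

definition eigen_decomp :: "nat \<Rightarrow> (nat \<Rightarrow> nat \<Rightarrow> real) \<Rightarrow> (nat \<Rightarrow> real) \<Rightarrow> (nat \<Rightarrow> nat \<Rightarrow> real) \<Rightarrow> bool" where
  "eigen_decomp n M l u \<longleftrightarrow> orthonormal n u \<and>
    (\<forall>i<n. \<forall>j<n. M i j = (\<Sum>k<n. l k * u k i * u k j))"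

lemma eigen_decomp_exists:
  assumes sym: "\<And>i j. i < n \<Longrightarrow> j < n \<Longrightarrow> M i j = M j i"
  shows "\<exists>l u. eigen_decomp n M l u"
proof -
  define A where "A = mat n n (\<lambda>(i, j). M i j)"
  have A: "A \<in> carrier_mat n n" by (simp add: A_def)
  have "A\<^sup>T = A" unfolding A_def by (rule eq_matI) (auto intro: sym)
  from real_spectral_theorem[OF A this] obtain U l where
    U: "U \<in> carrier_mat n n" "U\<^sup>T * U = 1\<^sub>m n" and AU: "A = U * mat_diag n l * U\<^sup>T" by auto
  have UT: "U\<^sup>T \<in> carrier_mat n n" using U by simp
  have UU: "U * U\<^sup>T = 1\<^sub>m n" using mat_mult_left_right_inverse[OF UT U(1,2)] .
  define u where "u = (\<lambda>k i. U $$ (i, k))"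
  have D: "mat_diag n l \<in> carrier_mat n n" by (simp add: mat_diag_def)
  have 1: "(\<Sum>i<n. u k i * u k' i) = of_bool (k = k')" if "k < n" "k' < n" for k k'
  proof -
    have "(U\<^sup>T * U) $$ (k, k') = (\<Sum>i<n. u k i * u k' i)"
      using that U(1) by (simp add: scalar_prod_def u_def lessThan_atLeast0)
    then show ?thesis using that by (auto simp: U(2) split: if_splits)
  qed
  have 2: "(\<Sum>k<n. u k i * u k j) = of_bool (i = j)" if "i < n" "j < n" for i j
  proof -
    have "(U * U\<^sup>T) $$ (i, j) = (\<Sum>k<n. u k i * u k j)"
      using that U(1) by (simp add: scalar_prod_def u_def lessThan_atLeast0)
    then show ?thesis using that by (auto simp: UU split: if_splits)
  qed
  have 3: "M i j = (\<Sum>k<n. l k * u k i * u k j)" if "i < n" "j < n" for i j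
  proof -
    define E where "E = U * mat_diag n l"
    have E: "E \<in> carrier_mat n n" unfolding E_def using U(1) D by (rule mult_carrier_mat)
    have "M i j = A $$ (i, j)" using that by (simp add: A_def)
    also have "\<dots> = (\<Sum>k<n. E $$ (i, k) * U $$ (j, k))"
      unfolding AU E_def[symmetric] using that U(1) E by (simp add: scalar_prod_def lessThan_atLeast0)
    also have "\<dots> = (\<Sum>k<n. l k * u k i * u k j)"
      using that U(1) by (intro sum.cong refl) (simp add: E_def mat_diag_mult_right[OF U(1)] u_def mult_ac)
    finally show ?thesis .
  qed
  show ?thesis using 1 2 3 unfolding eigen_decomp_def orthonormal_def by blast
qed

text \<open>
  This holds for every decomposition, not only for the one provided by the spectral theorem. So a
  decomposition can be rescaled without a new computation of the characteristic polynomial.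
\<close>

lemma mat_energy_eigen_decomp:
  assumes "eigen_decomp n M l u"
  shows "mat_energy n M = (\<Sum>k<n. \<bar>l k\<bar>)"
proof -
  define A where "A = mat n n (\<lambda>(i, j). M i j)"
  define U where "U = mat n n (\<lambda>(i, k). u k i)"
  have A: "A \<in> carrier_mat n n" and U: "U \<in> carrier_mat n n" and UT: "U\<^sup>T \<in> carrier_mat n n"
    by (simp_all add: A_def U_def)
  have D: "mat_diag n l \<in> carrier_mat n n" by (simp add: mat_diag_def)
  have UU: "U\<^sup>T * U = 1\<^sub>m n"
    using assms by (intro eq_matI)
      (auto simp: U_def scalar_prod_def eigen_decomp_def orthonormal_def lessThan_atLeast0)
  have UU': "U * U\<^sup>T = 1\<^sub>m n"
    using mat_mult_left_right_inverse[OF UT U UU] .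
  define E where "E = U * mat_diag n l"
  have E: "E \<in> carrier_mat n n" unfolding E_def using U D by (rule mult_carrier_mat)
  have Eij: "E $$ (i, k) = l k * u k i" if "i < n" "k < n" for i k
    unfolding E_def mat_diag_mult_right[OF U] using that by (simp add: U_def)
  have AU: "A = U * mat_diag n l * U\<^sup>T"
    unfolding E_def[symmetric] using assms E
    by (intro eq_matI)
      (auto simp: A_def U_def Eij scalar_prod_def eigen_decomp_def lessThan_atLeast0)
  have "similar_mat A (mat_diag n l)"
    unfolding similar_mat_def using similar_mat_witI[OF UU' UU AU A D U UT] by blast
  then have "char_poly A = char_poly (mat_diag n l)" by (rule char_poly_similar)
  also have "\<dots> = (\<Prod>a\<leftarrow>diag_mat (mat_diag n l). [:- a, 1:])"
    by (rule char_poly_upper_triangular[OF D]) (auto simp: mat_diag_def)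
  also have "diag_mat (mat_diag n l) = map l [0..<n]"
    by (auto simp: diag_mat_def mat_diag_def)
  finally have cp: "char_poly A = (\<Prod>k\<in>{..<n}. [:- l k, 1:])"
    using prod.distinct_set_conv_list[of "[0..<n]" "\<lambda>k. [:- l k, 1:]"]
    by (simp add: comp_def lessThan_atLeast0)
  have "proots (char_poly A) = (\<Sum>k\<in>{..<n}. {#l k#})"
    unfolding cp by (subst proots_prod) auto
  also have "\<dots> = image_mset l (mset_set {..<n})"
    by (simp add: sum_unfold_sum_mset flip: image_mset.compositionality)
  finally show ?thesis
    unfolding energy_def mat_energy_def A_def[symmetric]
    by (simp add: image_mset.compositionality comp_def sum_unfold_sum_mset)
qed

section \<open>Perturbation of the energy\<close>

definition quad_form :: "nat \<Rightarrow> (nat \<Rightarrow> nat \<Rightarrow> real) \<Rightarrow> (nat \<Rightarrow> real) \<Rightarrow> real" where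
  "quad_form n Z x = (\<Sum>i<n. \<Sum>j<n. x i * Z i j * x j)"

lemma parseval:
  assumes "orthonormal n u"
  shows "(\<Sum>k<n. (\<Sum>i<n. u k i * x i)\<^sup>2) = (\<Sum>i<n. (x i)\<^sup>2)"
proof -
  have "(\<Sum>k<n. (\<Sum>i<n. u k i * x i)\<^sup>2) = (\<Sum>k<n. \<Sum>i<n. \<Sum>j<n. x i * x j * (u k i * u k j))"
    by (simp add: power2_eq_square sum_product mult_ac)
  also have "\<dots> = (\<Sum>i<n. \<Sum>k<n. \<Sum>j<n. x i * x j * (u k i * u k j))"
    by (rule sum.swap)
  also have "\<dots> = (\<Sum>i<n. \<Sum>j<n. \<Sum>k<n. x i * x j * (u k i * u k j))"
    by (intro sum.cong refl sum.swap)
  also have "\<dots> = (\<Sum>i<n. \<Sum>j<n. x i * x j * of_bool (i = j))"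
    using assms unfolding orthonormal_def by (simp flip: sum_distrib_left)
  also have "\<dots> = (\<Sum>i<n. (x i)\<^sup>2)"
    by (simp add: of_bool_def power2_eq_square if_distrib[of "\<lambda>x. _ * x"] sum.delta cong: if_cong)
  finally show ?thesis .
qed

lemma quad_form_eigen_decomp:
  assumes "eigen_decomp n M l u"
  shows "quad_form n M x = (\<Sum>k<n. l k * (\<Sum>i<n. u k i * x i)\<^sup>2)"
proof -
  have "quad_form n M x = (\<Sum>i<n. \<Sum>j<n. \<Sum>k<n. l k * (u k i * x i) * (u k j * x j))"
    using assms unfolding eigen_decomp_def quad_form_def
    by (simp add: sum_distrib_left sum_distrib_right mult_ac)
  also have "\<dots> = (\<Sum>i<n. \<Sum>k<n. \<Sum>j<n. l k * (u k i * x i) * (u k j * x j))"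
    by (intro sum.cong refl sum.swap)
  also have "\<dots> = (\<Sum>k<n. \<Sum>i<n. \<Sum>j<n. l k * (u k i * x i) * (u k j * x j))"
    by (rule sum.swap)
  also have "\<dots> = (\<Sum>k<n. l k * (\<Sum>i<n. u k i * x i)\<^sup>2)"
    by (simp add: power2_eq_square sum_product sum_distrib_left mult_ac)
  finally show ?thesis .
qed

text \<open>
  One half of the variational characterisation of the trace norm. The eigenvalues of \<open>X\<close> are its
  quadratic form on its own eigenbasis, and on any orthonormal basis the quadratic form of
  \<open>Y\<close> sums in absolute value to at most the energy of \<open>Y\<close>, since the squared
  coefficients of an eigenvector of \<open>Y\<close> add up to one.
\<close>

lemma mat_energy_le_quad_forms:
  assumes X: "eigen_decomp n X l u" and Y: "eigen_decomp n Y m v"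
  shows "mat_energy n X \<le> mat_energy n Y + (\<Sum>k<n. \<bar>quad_form n (\<lambda>i j. X i j - Y i j) (u k)\<bar>)"
proof -
  have u: "orthonormal n u" and v: "orthonormal n v"
    using X Y by (auto simp: eigen_decomp_def)
  have lk: "l k = quad_form n X (u k)" if "k < n" for k
  proof -
    have "quad_form n X (u k) = (\<Sum>k'<n. l k' * (of_bool (k' = k))\<^sup>2)"
      unfolding quad_form_eigen_decomp[OF X] using u that by (simp add: orthonormal_def)
    also have "\<dots> = l k" using that
      by (simp add: of_bool_def if_distrib[of "\<lambda>x. _ * x"] if_distrib[of "\<lambda>x. x ^ 2"] cong: if_cong)
    finally show ?thesis by simp
  qed
  have "mat_energy n X = (\<Sum>k<n. \<bar>quad_form n X (u k)\<bar>)"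
    using lk by (simp add: mat_energy_eigen_decomp[OF X])
  also have "\<dots> \<le> (\<Sum>k<n. \<bar>quad_form n Y (u k)\<bar> + \<bar>quad_form n (\<lambda>i j. X i j - Y i j) (u k)\<bar>)"
  proof (rule sum_mono)
    fix k
    have "quad_form n X (u k) = quad_form n Y (u k) + quad_form n (\<lambda>i j. X i j - Y i j) (u k)"
      unfolding quad_form_def by (simp add: algebra_simps flip: sum.distrib)
    then show "\<bar>quad_form n X (u k)\<bar> \<le> \<bar>quad_form n Y (u k)\<bar> + \<bar>quad_form n (\<lambda>i j. X i j - Y i j) (u k)\<bar>"
      by linarith
  qed
  also have "\<dots> = (\<Sum>k<n. \<bar>quad_form n Y (u k)\<bar>) + (\<Sum>k<n. \<bar>quad_form n (\<lambda>i j. X i j - Y i j) (u k)\<bar>)"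
    by (rule sum.distrib)
  also have "(\<Sum>k<n. \<bar>quad_form n Y (u k)\<bar>) \<le> (\<Sum>k<n. \<Sum>k'<n. \<bar>m k'\<bar> * (\<Sum>i<n. v k' i * u k i)\<^sup>2)"
    unfolding quad_form_eigen_decomp[OF Y]
    by (intro sum_mono order_trans[OF sum_abs]) (simp add: abs_mult)
  also have "\<dots> = (\<Sum>k'<n. \<Sum>k<n. \<bar>m k'\<bar> * (\<Sum>i<n. v k' i * u k i)\<^sup>2)"
    by (rule sum.swap)
  also have "\<dots> = (\<Sum>k'<n. \<bar>m k'\<bar> * (\<Sum>k<n. (\<Sum>i<n. u k i * v k' i)\<^sup>2))"
    by (simp add: sum_distrib_left mult.commute)
  also have "\<dots> = mat_energy n Y"
  proof -
    have "(\<Sum>i<n. (v k i)\<^sup>2) = 1" if "k < n" for k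
      using v that by (simp add: orthonormal_def power2_eq_square)
    then show ?thesis unfolding parseval[OF u] by (simp add: mat_energy_eigen_decomp[OF Y])
  qed
  finally show ?thesis by simp
qed

text \<open>
  The three terms bound the trace norms of a rank one matrix, a diagonal matrix and a general matrix,
  the last one by \<open>\<surd>n\<close> times its Frobenius norm. The rank one part must be separated since
  its Frobenius norm would cost an extra factor \<open>\<surd>n\<close>.
\<close>

lemma sum_quad_forms_bound:
  assumes u: "orthonormal n u"
    and Z: "\<And>i j. i < n \<Longrightarrow> j < n \<Longrightarrow> Z i j = c * d i * d j + (if i = j then a i else 0) + S i j"
  shows "(\<Sum>k<n. \<bar>quad_form n Z (u k)\<bar>) \<le>
    \<bar>c\<bar> * (\<Sum>i<n. (d i)\<^sup>2) + (\<Sum>i<n. \<bar>a i\<bar>) + sqrt (real n) * sqrt (\<Sum>i<n. \<Sum>j<n. (S i j)\<^sup>2)"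
proof -
  have unit: "(\<Sum>i<n. (u k i)\<^sup>2) = 1" if "k < n" for k
    using u that by (simp add: orthonormal_def power2_eq_square)
  have unit': "(\<Sum>k<n. (u k i)\<^sup>2) = 1" if "i < n" for i
    using u that by (simp add: orthonormal_def power2_eq_square)
  have split: "quad_form n Z (u k) = c * (\<Sum>i<n. u k i * d i)\<^sup>2 + (\<Sum>i<n. a i * (u k i)\<^sup>2) + quad_form n S (u k)" for k
  proof -
    have "quad_form n Z (u k) = (\<Sum>i<n. \<Sum>j<n. c * (u k i * d i) * (u k j * d j)
       + (if i = j then a i * (u k i)\<^sup>2 else 0) + u k i * S i j * u k j)"
      unfolding quad_form_def by (intro sum.cong refl) (auto simp: Z algebra_simps power2_eq_square)
    then show ?thesis unfolding quad_form_def
      by (simp add: sum.distrib power2_eq_square sum_product sum_distrib_left mult_ac)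
  qed
  have "(\<Sum>k<n. \<bar>quad_form n Z (u k)\<bar>) \<le> (\<Sum>k<n. \<bar>c\<bar> * (\<Sum>i<n. u k i * d i)\<^sup>2
      + (\<Sum>i<n. \<bar>a i\<bar> * (u k i)\<^sup>2) + \<bar>quad_form n S (u k)\<bar>)"
  proof (rule sum_mono)
    fix k
    have "\<bar>\<Sum>i<n. a i * (u k i)\<^sup>2\<bar> \<le> (\<Sum>i<n. \<bar>a i\<bar> * (u k i)\<^sup>2)"
      by (rule order_trans[OF sum_abs]) (simp add: abs_mult)
    moreover have "\<bar>c * (\<Sum>i<n. u k i * d i)\<^sup>2\<bar> = \<bar>c\<bar> * (\<Sum>i<n. u k i * d i)\<^sup>2"
      by (simp add: abs_mult)
    ultimately show "\<bar>quad_form n Z (u k)\<bar> \<le> \<bar>c\<bar> * (\<Sum>i<n. u k i * d i)\<^sup>2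
      + (\<Sum>i<n. \<bar>a i\<bar> * (u k i)\<^sup>2) + \<bar>quad_form n S (u k)\<bar>"
      unfolding split by linarith
  qed
  also have "\<dots> = \<bar>c\<bar> * (\<Sum>k<n. (\<Sum>i<n. u k i * d i)\<^sup>2) + (\<Sum>k<n. \<Sum>i<n. \<bar>a i\<bar> * (u k i)\<^sup>2)
      + (\<Sum>k<n. \<bar>quad_form n S (u k)\<bar>)"
    by (simp add: sum.distrib sum_distrib_left)
  also have "(\<Sum>k<n. \<Sum>i<n. \<bar>a i\<bar> * (u k i)\<^sup>2) = (\<Sum>i<n. \<bar>a i\<bar>)"
    by (subst sum.swap) (simp add: unit' flip: sum_distrib_left)
  also have "(\<Sum>k<n. (\<Sum>i<n. u k i * d i)\<^sup>2) = (\<Sum>i<n. (d i)\<^sup>2)" by (rule parseval[OF u])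
  also have "(\<Sum>k<n. \<bar>quad_form n S (u k)\<bar>) \<le> sqrt (real n) * sqrt (\<Sum>i<n. \<Sum>j<n. (S i j)\<^sup>2)"
  proof -
    have 1: "(\<Sum>k<n. \<bar>quad_form n S (u k)\<bar>)\<^sup>2 \<le> (\<Sum>k<n. \<bar>quad_form n S (u k)\<bar>\<^sup>2) * real n"
      using sum_squared_le_sum_of_squares[of "\<lambda>k. \<bar>quad_form n S (u k)\<bar>" "{..<n}"] by simp
    have "(\<Sum>k<n. \<bar>quad_form n S (u k)\<bar>\<^sup>2) \<le> (\<Sum>k<n. \<Sum>i<n. (\<Sum>j<n. u k j * S i j)\<^sup>2)"
    proof (rule sum_mono)
      fix k assume k: "k \<in> {..<n}"
      have "quad_form n S (u k) = (\<Sum>i<n. u k i * (\<Sum>j<n. u k j * S i j))"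
        unfolding quad_form_def by (simp add: sum_distrib_left mult_ac)
      then have "\<bar>quad_form n S (u k)\<bar>\<^sup>2 \<le> (\<Sum>i<n. (u k i)\<^sup>2) * (\<Sum>i<n. (\<Sum>j<n. u k j * S i j)\<^sup>2)"
        by (simp add: Cauchy_Schwarz_ineq_sum)
      then show "\<bar>quad_form n S (u k)\<bar>\<^sup>2 \<le> (\<Sum>i<n. (\<Sum>j<n. u k j * S i j)\<^sup>2)"
        using k by (simp add: unit)
    qed
    also have "(\<Sum>k<n. \<Sum>i<n. (\<Sum>j<n. u k j * S i j)\<^sup>2) = (\<Sum>i<n. \<Sum>j<n. (S i j)\<^sup>2)"
      by (subst sum.swap) (simp add: parseval[OF u])
    finally have "(\<Sum>k<n. \<bar>quad_form n S (u k)\<bar>\<^sup>2) * real n \<le> (\<Sum>i<n. \<Sum>j<n. (S i j)\<^sup>2) * real n"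
      by (intro mult_right_mono) auto
    with 1 have "(\<Sum>k<n. \<bar>quad_form n S (u k)\<bar>)\<^sup>2 \<le> (sqrt (real n) * sqrt (\<Sum>i<n. \<Sum>j<n. (S i j)\<^sup>2))\<^sup>2"
      by (simp add: power_mult_distrib sum_nonneg mult.commute)
    then show ?thesis by (rule power2_le_imp_le) (simp add: sum_nonneg)
  qed
  finally show ?thesis by simp
qed

theorem mat_energy_perturbation:
  assumes X: "\<And>i j. i < n \<Longrightarrow> j < n \<Longrightarrow> X i j = X j i"
    and Y: "\<And>i j. i < n \<Longrightarrow> j < n \<Longrightarrow> Y i j = Y j i"
    and XY: "\<And>i j. i < n \<Longrightarrow> j < n \<Longrightarrow> X i j = Y i j + c * d i * d j + (if i = j then a i else 0) + S i j"
  shows "\<bar>mat_energy n X - mat_energy n Y\<bar> \<le>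
    \<bar>c\<bar> * (\<Sum>i<n. (d i)\<^sup>2) + (\<Sum>i<n. \<bar>a i\<bar>) + sqrt (real n) * sqrt (\<Sum>i<n. \<Sum>j<n. (S i j)\<^sup>2)"
    (is "_ \<le> ?B")
proof -
  obtain l u where X': "eigen_decomp n X l u" using eigen_decomp_exists[of n X] X by blast
  obtain m v where Y': "eigen_decomp n Y m v" using eigen_decomp_exists[of n Y] Y by blast
  have "mat_energy n X \<le> mat_energy n Y + ?B"
    using mat_energy_le_quad_forms[OF X' Y']
      sum_quad_forms_bound[of n u "\<lambda>i j. X i j - Y i j" c d a S] X' XY
    by (auto simp: eigen_decomp_def)
  moreover have "(\<Sum>k<n. \<bar>quad_form n (\<lambda>i j. Y i j - X i j) (v k)\<bar>) \<le> ?B"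
    using sum_quad_forms_bound[of n v "\<lambda>i j. Y i j - X i j" "- c" d "\<lambda>i. - a i" "\<lambda>i j. - S i j"] Y' XY
    by (auto simp: eigen_decomp_def)
  ultimately show ?thesis using mat_energy_le_quad_forms[OF Y' X'] by linarith
qed

lemma mat_energy_scale:
  assumes X: "\<And>i j. i < n \<Longrightarrow> j < n \<Longrightarrow> X i j = X j i"
  shows "mat_energy n (\<lambda>i j. c * X i j) = \<bar>c\<bar> * mat_energy n X"
proof -
  obtain l u where l: "eigen_decomp n X l u" using eigen_decomp_exists[of n X] X by blast
  then have "eigen_decomp n (\<lambda>i j. c * X i j) (\<lambda>k. c * l k) u"
    by (simp add: eigen_decomp_def sum_distrib_left mult_ac)
  from mat_energy_eigen_decomp[OF this] mat_energy_eigen_decomp[OF l] show ?thesis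
    by (simp add: abs_mult sum_distrib_left)
qed

section \<open>Products of Bernoulli variables\<close>

abbreviation bern_prod :: "'a set \<Rightarrow> real \<Rightarrow> ('a \<Rightarrow> bool) pmf" where
  "bern_prod S p \<equiv> Pi_pmf S False (\<lambda>_. bernoulli_pmf p)"

abbreviation bern_exp :: "'a set \<Rightarrow> real \<Rightarrow> (('a \<Rightarrow> bool) \<Rightarrow> 'b :: {banach, second_countable_topology}) \<Rightarrow> 'b" where
  "bern_exp S p f \<equiv> measure_pmf.expectation (bern_prod S p) f"

lemma finite_bern_prod [simp]: "finite S \<Longrightarrow> finite (set_pmf (bern_prod S p))"
  by (rule finite_subset[OF set_Pi_pmf_subset'], assumption, rule finite_PiE_dflt) auto

lemma integrable_bern_prod [simp, intro]:
  fixes f :: "('a \<Rightarrow> bool) \<Rightarrow> 'b :: {banach, second_countable_topology}"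
  shows "finite S \<Longrightarrow> integrable (bern_prod S p) f"
  by (rule integrable_measure_pmf_finite) simp

lemma expectation_bern_insert:
  fixes f :: "('a \<Rightarrow> bool) \<Rightarrow> 'b :: {banach, second_countable_topology}"
  assumes p: "0 \<le> p" "p \<le> 1" and S: "finite S" "e \<notin> S"
  shows "bern_exp (insert e S) p f =
    p *\<^sub>R bern_exp S p (\<lambda>X. f (X(e := True))) + (1 - p) *\<^sub>R bern_exp S p (\<lambda>X. f (X(e := False)))"
proof -
  have "bern_exp (insert e S) p f = measure_pmf.expectation (pair_pmf (bernoulli_pmf p) (bern_prod S p)) (\<lambda>(b, X). f (X(e := b)))"
    by (subst Pi_pmf_insert[OF S]) (simp add: case_prod_unfold)
  also have "\<dots> = measure_pmf.expectation (bernoulli_pmf p) (\<lambda>b. bern_exp S p (\<lambda>X. f (X(e := b))))"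
    unfolding pair_pmf_def
    by (subst pmf_expectation_bind[where A = UNIV]) 
      (auto simp: S integral_measure_pmf[of UNIV] simp flip: map_pmf_def)
  also have "\<dots> = p *\<^sub>R bern_exp S p (\<lambda>X. f (X(e := True))) + (1 - p) *\<^sub>R bern_exp S p (\<lambda>X. f (X(e := False)))"
    using p by (simp add: integral_measure_pmf[of UNIV] UNIV_bool)
  finally show ?thesis .
qed

text \<open>
  Averaging over a fresh value of one coordinate does not change the expectation. Integration by
  parts and the estimate for pairs without common neighbours both rest on this identity.
\<close>

lemma expectation_bern_resample:
  fixes f :: "('a \<Rightarrow> bool) \<Rightarrow> 'b :: {banach, second_countable_topology}"
  assumes p: "0 \<le> p" "p \<le> 1" and S: "finite S" "e \<in> S"
  shows "bern_exp S p f =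
    bern_exp S p (\<lambda>X. p *\<^sub>R f (X(e := True)) + (1 - p) *\<^sub>R f (X(e := False)))"
proof -
  let ?S = "S - {e}"
  have ins: "insert e ?S = S" and "e \<notin> ?S" "finite ?S" using S by auto
  note I = expectation_bern_insert[OF p \<open>finite ?S\<close> \<open>e \<notin> ?S\<close>, unfolded ins]
  show ?thesis
    by (subst (1 2) I) (simp add: S flip: scaleR_left_distrib)
qed

text \<open>
  A discrete counterpart of Gaussian integration by parts. The two values of a Bernoulli variable
  differ by one, so the derivative becomes a finite difference and there is no remainder term.
\<close>

lemma expectation_bern_by_parts:
  fixes f :: "('a \<Rightarrow> bool) \<Rightarrow> 'b :: {banach, second_countable_topology}"
  assumes p: "0 \<le> p" "p \<le> 1" and S: "finite S" "e \<in> S"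
  shows "bern_exp S p (\<lambda>X. (of_bool (X e) - p) *\<^sub>R f X) =
    (p * (1 - p)) *\<^sub>R bern_exp S p (\<lambda>X. f (X(e := True)) - f (X(e := False)))"
  by (subst expectation_bern_resample[OF p S])
     (simp add: S algebra_simps scaleR_right_diff_distrib flip: integral_scaleR_right)

text \<open>
  The Efron--Stein inequality for bounded differences. Splitting off one coordinate, the variance is
  the mean of the two conditional variances plus \<open>p(1-p)\<close> times the squared difference of
  the conditional expectations.
\<close>

lemma variance_bern_bounded_differences:
  fixes f :: "('a \<Rightarrow> bool) \<Rightarrow> real"
  assumes p: "0 \<le> p" "p \<le> 1" and S: "finite S"
    and c: "\<And>X e. e \<in> S \<Longrightarrow> \<bar>f (X(e := True)) - f (X(e := False))\<bar> \<le> c e"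
  shows "bern_exp S p (\<lambda>X. (f X - bern_exp S p f)\<^sup>2) \<le> p * (1 - p) * (\<Sum>e\<in>S. (c e)\<^sup>2)"
proof -
  have var: "bern_exp S p (\<lambda>X. (g X - bern_exp S p g)\<^sup>2) = bern_exp S p (\<lambda>X. (g X)\<^sup>2) - (bern_exp S p g)\<^sup>2"
    if "finite S" for S and g :: "('a \<Rightarrow> bool) \<Rightarrow> real"
    using that by (simp add: measure_pmf.variance_eq)
  have "bern_exp S p (\<lambda>X. (f X)\<^sup>2) - (bern_exp S p f)\<^sup>2 \<le> p * (1 - p) * (\<Sum>e\<in>S. (c e)\<^sup>2)"
    using S c
  proof (induction S arbitrary: f rule: finite_induct)
    case empty
    then show ?case by simp
  next
    case (insert e S)
    note E = expectation_bern_insert[OF p insert.hyps(1,2)]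
    let ?f1 = "\<lambda>X. f (X(e := True))" and ?f0 = "\<lambda>X. f (X(e := False))"
    let ?A = "bern_exp S p ?f1" and ?B = "bern_exp S p ?f0"
    let ?C = "p * (1 - p) * (\<Sum>e\<in>S. (c e)\<^sup>2)"
    have 1: "bern_exp S p (\<lambda>X. (?f1 X)\<^sup>2) - ?A\<^sup>2 \<le> ?C"
      using insert.hyps insert.prems by (intro insert.IH) (metis fun_upd_twist insertCI)
    have 0: "bern_exp S p (\<lambda>X. (?f0 X)\<^sup>2) - ?B\<^sup>2 \<le> ?C"
      using insert.hyps insert.prems by (intro insert.IH) (metis fun_upd_twist insertCI)
    have "\<bar>?A - ?B\<bar> = \<bar>bern_exp S p (\<lambda>X. ?f1 X - ?f0 X)\<bar>" using insert.hyps by simp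
    also have "\<dots> \<le> bern_exp S p (\<lambda>X. \<bar>?f1 X - ?f0 X\<bar>)" by (rule integral_abs_bound)
    also have "\<dots> \<le> bern_exp S p (\<lambda>X. c e)" 
      by (intro integral_mono insert.prems insertI1 integrable_bern_prod insert.hyps)
    finally have "\<bar>?A - ?B\<bar> \<le> c e" by simp
    then have AB: "(?A - ?B)\<^sup>2 \<le> (c e)\<^sup>2" by (metis abs_ge_zero power2_abs power_mono)
    have "bern_exp (insert e S) p (\<lambda>X. (f X)\<^sup>2) - (bern_exp (insert e S) p f)\<^sup>2 =
      p * (bern_exp S p (\<lambda>X. (?f1 X)\<^sup>2) - ?A\<^sup>2) + (1 - p) * (bern_exp S p (\<lambda>X. (?f0 X)\<^sup>2) - ?B\<^sup>2)
        + p * (1 - p) * (?A - ?B)\<^sup>2"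
      unfolding E by (simp add: algebra_simps power2_eq_square)
    also have "\<dots> \<le> p * ?C + (1 - p) * ?C + p * (1 - p) * (c e)\<^sup>2"
      using p 0 1 AB by (intro add_mono mult_left_mono) auto
    also have "\<dots> = p * (1 - p) * (\<Sum>e\<in>insert e S. (c e)\<^sup>2)"
      using insert.hyps by (simp add: algebra_simps)
    finally show ?case .
  qed
  then show ?thesis using var[OF S] by simp
qed

section \<open>Resolvents on the imaginary axis\<close>

text \<open>
  The entries of \<open>(M - it)\<^sup>-\<^sup>1\<close>, where \<open>l\<close> and \<open>u\<close> are the eigenvalues and
  eigenvectors of \<open>M\<close>.
\<close>

definition resolvent :: "nat \<Rightarrow> (nat \<Rightarrow> real) \<Rightarrow> (nat \<Rightarrow> nat \<Rightarrow> real) \<Rightarrow> real \<Rightarrow> nat \<Rightarrow> nat \<Rightarrow> complex" where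
  "resolvent n l u t i j = (\<Sum>k<n. of_real (u k i * u k j) / Complex (l k) (- t))"

lemma resolvent_sym: "resolvent n l u t i j = resolvent n l u t j i"
  by (simp add: resolvent_def mult.commute)

lemma eigen_decomp_sym:
  "eigen_decomp n M l u \<Longrightarrow> i < n \<Longrightarrow> j < n \<Longrightarrow> M i j = M j i"
  by (simp add: eigen_decomp_def mult_ac)

lemma mult_resolvent:
  assumes M: "eigen_decomp n M l u" and t: "t > 0" and ab: "a < n" "b < n"
  shows "(\<Sum>j<n. of_real (M a j) * resolvent n l u t j b) =
    of_bool (a = b) + \<i> * of_real t * resolvent n l u t a b"
proof -
  have u: "orthonormal n u" using M by (simp add: eigen_decomp_def)
  define z where "z = (\<lambda>k. Complex (l k) (- t))"
  have z0: "z k \<noteq> 0" for k using t by (simp add: z_def complex_eq_iff)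
  have zl: "of_real (l k) = z k + \<i> * of_real t" for k by (simp add: z_def complex_eq_iff)
  have "(\<Sum>j<n. of_real (M a j) * resolvent n l u t j b) =
    (\<Sum>j<n. \<Sum>k<n. \<Sum>k'<n. of_real (l k * u k a * u k' b) / z k' * of_real (u k j * u k' j))"
    using M ab unfolding resolvent_def eigen_decomp_def z_def
    by (simp add: sum_product mult_ac divide_inverse)
  also have "\<dots> = (\<Sum>k<n. \<Sum>j<n. \<Sum>k'<n. of_real (l k * u k a * u k' b) / z k' * of_real (u k j * u k' j))"
    by (rule sum.swap)
  also have "\<dots> = (\<Sum>k<n. \<Sum>k'<n. \<Sum>j<n. of_real (l k * u k a * u k' b) / z k' * of_real (u k j * u k' j))"
    by (intro sum.cong refl sum.swap)
  also have "\<dots> = (\<Sum>k<n. \<Sum>k'<n. of_real (l k * u k a * u k' b) / z k' * of_real (of_bool (k = k')))"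
  proof (intro sum.cong refl)
    fix k k' assume "k \<in> {..<n}" "k' \<in> {..<n}"
    then have "(\<Sum>j<n. u k j * u k' j) = of_bool (k = k')" using u by (simp add: orthonormal_def)
    then show "(\<Sum>j<n. of_real (l k * u k a * u k' b) / z k' * of_real (u k j * u k' j)) =
      of_real (l k * u k a * u k' b) / z k' * of_real (of_bool (k = k'))"
      by (simp only: sum_distrib_left[symmetric] of_real_sum[symmetric])
  qed
  also have "\<dots> = (\<Sum>k<n. of_real (l k * u k a * u k b) / z k)"
    by (simp add: of_bool_def if_distrib[of "\<lambda>x. _ * x"] if_distrib[of of_real] cong: if_cong)
  also have "\<dots> = (\<Sum>k<n. of_real (u k a * u k b) + \<i> * of_real t * (of_real (u k a * u k b) / z k))"
    using z0 by (intro sum.cong refl) (simp add: zl field_simps)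
  also have "\<dots> = of_real (\<Sum>k<n. u k a * u k b) + \<i> * of_real t * resolvent n l u t a b"
    unfolding resolvent_def z_def by (simp add: sum.distrib sum_distrib_left)
  also have "(\<Sum>k<n. u k a * u k b) = of_bool (a = b)" using u ab by (simp add: orthonormal_def)
  finally show ?thesis by simp
qed

text \<open>
  A row of the resolvent has the same norm as its coefficients in the orthonormal eigenbasis, and
  \<open>\<bar>l - it\<bar> \<ge> t\<close> for real \<open>l\<close>. The bounds on entries and on products are consequences.
\<close>

lemma resolvent_row_norm:
  assumes M: "eigen_decomp n M l u" and t: "t > 0" and i: "i < n"
  shows "(\<Sum>j<n. (cmod (resolvent n l u t i j))\<^sup>2) \<le> 1 / t\<^sup>2"
proof -
  define z where "z = (\<lambda>k. of_real (u k i) / Complex (l k) (- t))"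
  have u: "orthonormal n (\<lambda>j k. u k j)" and u': "orthonormal n u"
    using M by (auto simp: eigen_decomp_def orthonormal_def mult.commute)
  have R: "resolvent n l u t i j = (\<Sum>k<n. of_real (u k j) * z k)" for j
    unfolding resolvent_def z_def by (simp add: mult_ac)
  have "(\<Sum>j<n. (cmod (resolvent n l u t i j))\<^sup>2) =
     (\<Sum>j<n. (\<Sum>k<n. u k j * Re (z k))\<^sup>2) + (\<Sum>j<n. (\<Sum>k<n. u k j * Im (z k))\<^sup>2)"
    unfolding R cmod_power2 by (simp add: sum.distrib)
  also have "\<dots> = (\<Sum>k<n. (Re (z k))\<^sup>2) + (\<Sum>k<n. (Im (z k))\<^sup>2)"
    by (simp only: parseval[OF u])
  also have "\<dots> = (\<Sum>k<n. (cmod (z k))\<^sup>2)" by (simp add: cmod_power2 sum.distrib)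
  also have "\<dots> \<le> (\<Sum>k<n. (u k i)\<^sup>2 * (1 / t\<^sup>2))"
  proof (rule sum_mono)
    fix k
    have "(cmod (z k))\<^sup>2 = (u k i)\<^sup>2 / ((l k)\<^sup>2 + t\<^sup>2)"
      by (simp add: z_def norm_divide power_divide cmod_power2)
    also have "\<dots> \<le> (u k i)\<^sup>2 / t\<^sup>2" using t
      by (intro divide_left_mono mult_pos_pos) (auto intro: add_nonneg_pos)
    finally show "(cmod (z k))\<^sup>2 \<le> (u k i)\<^sup>2 * (1 / t\<^sup>2)" by simp
  qed
  also have "\<dots> = 1 / t\<^sup>2"
    using u' i unfolding sum_distrib_right[symmetric] by (simp add: orthonormal_def power2_eq_square)
  finally show ?thesis .
qed

lemma resolvent_entry_norm:
  assumes M: "eigen_decomp n M l u" and t: "t > 0" and i: "i < n" "j < n"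
  shows "cmod (resolvent n l u t i j) \<le> 1 / t"
proof -
  have "(cmod (resolvent n l u t i j))\<^sup>2 \<le> (\<Sum>j<n. (cmod (resolvent n l u t i j))\<^sup>2)"
    using i by (intro member_le_sum) auto
  also have "\<dots> \<le> (1 / t)\<^sup>2" using resolvent_row_norm[OF M t i(1)] by (simp add: power_one_over)
  finally show ?thesis by (rule power2_le_imp_le) (use t in simp)
qed

lemma resolvent_product_sum_norm:
  assumes M: "eigen_decomp n M l u" and M': "eigen_decomp n M' l' u'" and t: "t > 0"
    and i: "i < n" "j < n"
  shows "cmod (\<Sum>k<n. resolvent n l u t k i * resolvent n l' u' t j k) \<le> 1 / t\<^sup>2"
proof -
  let ?a = "\<lambda>k. cmod (resolvent n l u t i k)" and ?b = "\<lambda>k. cmod (resolvent n l' u' t j k)"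
  have "cmod (\<Sum>k<n. resolvent n l u t k i * resolvent n l' u' t j k) \<le> (\<Sum>k<n. ?a k * ?b k)"
    by (rule order_trans[OF norm_sum]) (simp add: norm_mult resolvent_sym[of n l u t _ i])
  also have "\<dots> \<le> (\<Sum>k<n. ((?a k)\<^sup>2 + (?b k)\<^sup>2) / 2)"
  proof (rule sum_mono)
    fix k
    show "?a k * ?b k \<le> ((?a k)\<^sup>2 + (?b k)\<^sup>2) / 2"
      using sum_squares_bound[of "?a k" "?b k"] by (simp add: field_simps)
  qed
  also have "\<dots> = ((\<Sum>k<n. (?a k)\<^sup>2) + (\<Sum>k<n. (?b k)\<^sup>2)) / 2"
    by (simp add: sum.distrib flip: sum_divide_distrib)
  also have "\<dots> \<le> 1 / t\<^sup>2"
    using resolvent_row_norm[OF M t i(1)] resolvent_row_norm[OF M' t i(2)] by simp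
  finally show ?thesis .
qed

lemma resolvent_trace:
  assumes M: "eigen_decomp n M l u"
  shows "(\<Sum>i<n. resolvent n l u t i i) = (\<Sum>k<n. 1 / Complex (l k) (- t))"
proof -
  have "(\<Sum>i<n. resolvent n l u t i i) = (\<Sum>k<n. \<Sum>i<n. of_real (u k i * u k i) / Complex (l k) (- t))"
    unfolding resolvent_def by (rule sum.swap)
  also have "\<dots> = (\<Sum>k<n. of_real (\<Sum>i<n. u k i * u k i) / Complex (l k) (- t))"
    by (simp add: sum_divide_distrib)
  also have "\<dots> = (\<Sum>k<n. 1 / Complex (l k) (- t))"
    using M by (simp add: eigen_decomp_def orthonormal_def del: of_real_sum of_real_mult)
  finally show ?thesis .
qed

lemma resolvent_identity:
  assumes M: "eigen_decomp n M l u" and M': "eigen_decomp n M' l' u'" and t: "t > 0"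
    and ab: "a < n" "b < n"
  defines "R \<equiv> resolvent n l u t" and "R' \<equiv> resolvent n l' u' t"
  shows "R' a b - R a b = (\<Sum>i<n. \<Sum>j<n. R' a i * of_real (M i j - M' i j) * R j b)"
proof -
  let ?P = "\<i> * of_real t * (\<Sum>i<n. R' a i * R i b)"
  have "(\<Sum>i<n. \<Sum>j<n. R' a i * of_real (M i j) * R j b) = (\<Sum>i<n. R' a i * (\<Sum>j<n. of_real (M i j) * R j b))"
    by (simp add: sum_distrib_left mult.assoc)
  also have "\<dots> = (\<Sum>i<n. R' a i * (of_bool (i = b) + \<i> * of_real t * R i b))"
    unfolding R_def using mult_resolvent[OF M t _ ab(2)] by simp
  also have "\<dots> = R' a b + ?P"
    using ab by (simp add: distrib_left sum.distrib sum_distrib_left mult_ac of_bool_def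
      if_distrib[of "\<lambda>x. _ * x"] cong: if_cong)
  finally have 1: "(\<Sum>i<n. \<Sum>j<n. R' a i * of_real (M i j) * R j b) = R' a b + ?P" .
  have "(\<Sum>i<n. \<Sum>j<n. R' a i * of_real (M' i j) * R j b) = (\<Sum>j<n. \<Sum>i<n. R' a i * of_real (M' i j) * R j b)"
    by (rule sum.swap)
  also have "\<dots> = (\<Sum>j<n. (\<Sum>i<n. of_real (M' j i) * R' i a) * R j b)"
    using eigen_decomp_sym[OF M'] unfolding R'_def
    by (intro sum.cong refl) (simp add: sum_distrib_left sum_distrib_right resolvent_sym[of n l' u' t a] mult_ac)
  also have "\<dots> = (\<Sum>j<n. (of_bool (j = a) + \<i> * of_real t * R' j a) * R j b)"
    unfolding R'_def using mult_resolvent[OF M' t _ ab(1)] by simp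
  also have "\<dots> = (\<Sum>j<n. (of_bool (j = a) + \<i> * of_real t * R' a j) * R j b)"
    unfolding R'_def by (intro sum.cong refl) (simp only: resolvent_sym[of n l' u' t _ a])
  also have "\<dots> = (\<Sum>j<n. of_bool (j = a) * R j b) + ?P"
    by (simp add: algebra_simps sum.distrib sum_distrib_left)
  also have "(\<Sum>j<n. of_bool (j = a) * R j b) = R a b"
    using ab by (simp add: of_bool_def if_distrib[of "\<lambda>x. x * _"] cong: if_cong)
  finally show ?thesis using 1
    by (simp add: algebra_simps sum_subtractf)
qed

text \<open>
  The resolvent identity for matrices that differ in one symmetric pair of off-diagonal entries, as
  the adjacency matrices of two graphs do that differ in one edge.
\<close>

lemma resolvent_entry_change:
  assumes M: "eigen_decomp n M l u" and M': "eigen_decomp n M' l' u'" and t: "t > 0"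
    and ab: "a < n" "b < n" and ij: "i < n" "j < n" "i \<noteq> j"
    and D: "\<And>x y. x < n \<Longrightarrow> y < n \<Longrightarrow> M x y - M' x y = c * of_bool ((x, y) \<in> {(i, j), (j, i)})"
  defines "R \<equiv> resolvent n l u t" and "R' \<equiv> resolvent n l' u' t"
  shows "R' a b - R a b = of_real c * (R' a i * R j b + R' a j * R i b)"
proof -
  have "R' a b - R a b = (\<Sum>x<n. \<Sum>y<n. R' a x * of_real (M x y - M' x y) * R y b)"
    unfolding R_def R'_def by (rule resolvent_identity[OF M M' t ab])
  also have "\<dots> = (\<Sum>x<n. \<Sum>y<n. (if x = i then if y = j then of_real c * (R' a i * R j b) else 0 else 0)
       + (if x = j then if y = i then of_real c * (R' a j * R i b) else 0 else 0))"
    using ij by (intro sum.cong refl) (auto simp: D)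
  also have "\<dots> = of_real c * (R' a i * R j b + R' a j * R i b)"
  proof -
    have N: "(\<Sum>x<n. \<Sum>y<n. if x = i then if y = j then z else 0 else 0) = z"
      if "i < n" "j < n" for i j and z :: complex
    proof -
      have "(\<Sum>y<n. if x = i then if y = j then z else 0 else 0) = (if x = i then z else 0)" for x
        using that by (cases "x = i") simp_all
      then show ?thesis using that by simp
    qed
    show ?thesis by (simp only: sum.distrib distrib_left N[OF ij(1,2)] N[OF ij(2,1)])
  qed
  finally show ?thesis .
qed

section \<open>The Stieltjes transform of the centred adjacency matrix\<close>

text \<open>
  The adjacency matrix of the graph given by the indicator function \<open>X\<close> of its edges, centred so
  that every entry has mean zero under the product of Bernoulli measures.
\<close>

definition wigner :: "real \<Rightarrow> (nat set \<Rightarrow> bool) \<Rightarrow> nat \<Rightarrow> nat \<Rightarrow> real" where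
  "wigner p X i j = (if i = j then 0 else of_bool (X {i, j}) - p)"

lemma wigner_sym: "wigner p X i j = wigner p X j i"
  by (simp add: wigner_def insert_commute)

lemma finite_all_edges [simp]: "finite (all_edges n)"
  by (rule finite_subset[of _ "Pow {0..<n}"]) (auto simp: all_edges_def)

lemma edge_mem: "i < n \<Longrightarrow> j < n \<Longrightarrow> i \<noteq> j \<Longrightarrow> {i, j} \<in> all_edges n"
  by (auto simp: all_edges_def)

lemma all_edgesE:
  assumes "e \<in> all_edges n"
  obtains i j where "i < n" "j < n" "i \<noteq> j" "e = {i, j}"
  using assms by (auto simp: all_edges_def card_2_iff)

lemma card_all_edges_le: "card (all_edges n) \<le> n\<^sup>2"
proof -
  have "all_edges n \<subseteq> (\<lambda>(i, j). {i, j}) ` ({..<n} \<times> {..<n})"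
    by (auto elim!: all_edgesE intro!: image_eqI)
  then have "card (all_edges n) \<le> card ((\<lambda>(i, j). {i, j}) ` ({..<n} \<times> {..<n}))"
    by (intro card_mono) auto
  also have "\<dots> \<le> card ({..<n} \<times> {..<n})" by (rule card_image_le) auto
  finally show ?thesis by (simp add: power2_eq_square card_cartesian_product)
qed

lemma wigner_flip:
  assumes "i \<noteq> j"
  shows "wigner p (X({i, j} := True)) x y - wigner p (X({i, j} := False)) x y =
    of_bool ((x, y) \<in> {(i, j), (j, i)})"
  using assms by (auto simp: wigner_def doubleton_eq_iff)

text \<open>
  The locale fixes, for every graph, a decomposition of the normalised centred adjacency matrix.
  The resolvent does not depend on the choice.
\<close>

locale wigner_resolvent =
  fixes n :: nat and p t :: real and l u
  assumes n: "n > 0" and p: "0 < p" "p < 1" and t: "t > 0"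
    and dec: "\<And>X. eigen_decomp n (\<lambda>i j. wigner p X i j / sqrt (real n)) (l X) (u X)"
begin

abbreviation avg :: "((nat set \<Rightarrow> bool) \<Rightarrow> 'b :: {banach, second_countable_topology}) \<Rightarrow> 'b" where
  "avg \<equiv> bern_exp (all_edges n) p"

definition R :: "(nat set \<Rightarrow> bool) \<Rightarrow> nat \<Rightarrow> nat \<Rightarrow> complex" where
  "R X = resolvent n (l X) (u X) t"

definition stieltjes :: "(nat set \<Rightarrow> bool) \<Rightarrow> complex" where
  "stieltjes X = (\<Sum>i<n. R X i i) / of_nat n"

abbreviation "v \<equiv> p * (1 - p)"
abbreviation "\<delta> \<equiv> 2 / (sqrt (real n) * t\<^sup>2)"

lemma v: "0 < v" "v \<le> 1"
proof -
  show "0 < v" using p by simp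
  have "p * (1 - p) \<le> 1 * 1" using p by (intro mult_mono) auto
  then show "v \<le> 1" by simp
qed

lemma R_le: "i < n \<Longrightarrow> j < n \<Longrightarrow> cmod (R X i j) \<le> 1 / t"
  unfolding R_def by (rule resolvent_entry_norm[OF dec t])

lemma R_flip:
  assumes "i < n" "j < n" "i \<noteq> j" "a < n" "b < n"
  shows "R (X({i, j} := False)) a b - R (X({i, j} := True)) a b = 
    of_real (1 / sqrt (real n)) * (R (X({i, j} := False)) a i * R (X({i, j} := True)) j b
      + R (X({i, j} := False)) a j * R (X({i, j} := True)) i b)"
  unfolding R_def
  by (rule resolvent_entry_change[OF dec dec t])
    (use assms in \<open>simp_all add: wigner_flip flip: diff_divide_distrib\<close>)

lemma R_flip_le:
  assumes "i < n" "j < n" "i \<noteq> j" "a < n" "b < n"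
  shows "cmod (R (X({i, j} := False)) a b - R (X({i, j} := True)) a b) \<le> \<delta>"
proof -
  let ?F = "X({i, j} := False)" and ?T = "X({i, j} := True)"
  have 1: "cmod (R ?F a x * R ?T y b) \<le> 1 / t * (1 / t)" if "x < n" "y < n" for x y
    unfolding norm_mult using t that assms by (intro mult_mono R_le) auto
  have "cmod (R ?F a i * R ?T j b + R ?F a j * R ?T i b) \<le> 1 / t * (1 / t) + 1 / t * (1 / t)"
    using assms 1 by (intro norm_triangle_le add_mono) auto
  then have "1 / sqrt (real n) * cmod (R ?F a i * R ?T j b + R ?F a j * R ?T i b)
      \<le> 1 / sqrt (real n) * (1 / t * (1 / t) + 1 / t * (1 / t))"
    by (rule mult_left_mono) simp
  also have "\<dots> = \<delta>" by (simp add: power2_eq_square)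
  also have "1 / sqrt (real n) * cmod (R ?F a i * R ?T j b + R ?F a j * R ?T i b) =
      cmod (R ?F a b - R ?T a b)"
    unfolding R_flip[OF assms] norm_mult norm_of_real by simp
  finally show ?thesis .
qed

text \<open>
  Integration by parts produces products in which one factor belongs to the graph without the edge
  and the other to the graph with it. One of these two graphs is \<open>X\<close>, so
  replacing both factors by those of \<open>X\<close> changes only one of them.
\<close>

lemma R_product_flip_le:
  assumes "i < n" "j < n" "i \<noteq> j" "a < n" "b < n" "c < n" "d < n"
  shows "cmod (R (X({i, j} := False)) a b * R (X({i, j} := True)) c d - R X a b * R X c d) \<le> \<delta> / t"
proof (cases "X {i, j}")
  case True
  then have T: "X({i, j} := True) = X" by (simp add: fun_upd_idem)
  have "R (X({i, j} := False)) a b * R (X({i, j} := True)) c d - R X a b * R X c d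
    = (R (X({i, j} := False)) a b - R (X({i, j} := True)) a b) * R X c d"
    unfolding T by (simp add: algebra_simps)
  also have "cmod \<dots> \<le> \<delta> * (1 / t)" unfolding norm_mult
    using assms t by (intro mult_mono R_flip_le R_le) auto
  finally show ?thesis by simp
next
  case False
  then have F: "X({i, j} := False) = X" by (simp add: fun_upd_idem)
  have "R (X({i, j} := False)) a b * R (X({i, j} := True)) c d - R X a b * R X c d
    = - ((R (X({i, j} := False)) c d - R (X({i, j} := True)) c d) * R X a b)"
    unfolding F by (simp add: algebra_simps)
  also have "cmod \<dots> \<le> \<delta> * (1 / t)" unfolding norm_minus_cancel norm_mult
    using assms t by (intro mult_mono R_flip_le R_le) auto
  finally show ?thesis by simp
qed

text \<open>
  Integration by parts followed by the resolvent identity turns a factor \<open>W\<^sub>i\<^sub>j\<close> into a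
  second resolvent entry. On the diagonal \<open>W\<close> vanishes, and the error is the product term itself.
\<close>

lemma entry_times_resolvent:
  assumes ij: "i < n" "j < n"
  shows "cmod (avg (\<lambda>X. of_real (wigner p X i j / sqrt (real n)) * R X j i)
     + of_real (v / n) * avg (\<lambda>X. R X j j * R X i i + (R X j i)\<^sup>2))
    \<le> v / n * (2 * (\<delta> / t)) + (if i = j then v / n * (2 / t\<^sup>2) else 0)"
proof (cases "i = j")
  case True
  have "cmod (avg (\<lambda>X. R X j j * R X i i + (R X j i)\<^sup>2)) \<le> avg (\<lambda>X. cmod (R X j j * R X i i + (R X j i)\<^sup>2))"
    by (rule integral_norm_bound)
  also have "\<dots> \<le> avg (\<lambda>X. 2 / t\<^sup>2)"
  proof (rule integral_mono)
    fix X
    have "cmod (R X j j * R X i i) \<le> 1 / t * (1 / t)"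
      unfolding norm_mult using ij t by (intro mult_mono R_le) auto
    moreover have "cmod ((R X j i)\<^sup>2) \<le> (1 / t)\<^sup>2"
      unfolding norm_power using ij by (intro power_mono R_le) auto
    ultimately have "cmod (R X j j * R X i i + (R X j i)\<^sup>2) \<le> 1 / t * (1 / t) + (1 / t)\<^sup>2"
      by (intro norm_triangle_le add_mono)
    then show "cmod (R X j j * R X i i + (R X j i)\<^sup>2) \<le> 2 / t\<^sup>2" by (simp add: power2_eq_square)
  qed auto
  finally have "cmod (avg (\<lambda>X. R X j j * R X i i + (R X j i)\<^sup>2)) \<le> 2 / t\<^sup>2" by simp
  then have le: "v / n * cmod (avg (\<lambda>X. R X j j * R X i i + (R X j i)\<^sup>2)) \<le> v / n * (2 / t\<^sup>2)"
    using v by (intro mult_left_mono) auto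
  have z: "avg (\<lambda>X. of_real (wigner p X i j / sqrt (real n)) * R X j i) = 0"
    using True by (simp add: wigner_def)
  have "0 \<le> v / n * (2 * (\<delta> / t))" and vn: "\<bar>v / n\<bar> = v / n" using v t by simp_all
  with le have "v / n * cmod (avg (\<lambda>X. R X j j * R X i i + (R X j i)\<^sup>2)) \<le>
      v / n * (2 * (\<delta> / t)) + v / n * (2 / t\<^sup>2)" by linarith
  then show ?thesis
    unfolding z add_0_left norm_mult norm_of_real vn using True by (simp only: if_True refl)
next
  case False
  let ?e = "{i, j}"
  let ?G = "\<lambda>X. R (X(?e := False)) j j * R (X(?e := True)) i i + R (X(?e := False)) j i * R (X(?e := True)) j i"
  have "avg (\<lambda>X. of_real (wigner p X i j / sqrt (real n)) * R X j i)
     = of_real (1 / sqrt (real n)) * avg (\<lambda>X. (of_bool (X ?e) - p) *\<^sub>R R X j i)"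
    using False by (subst integral_mult_right_zero[symmetric])
      (auto simp: wigner_def scaleR_conv_of_real mult_ac intro!: Bochner_Integration.integral_cong)
  also have "\<dots> = of_real (1 / sqrt (real n)) * (v *\<^sub>R avg (\<lambda>X. R (X(?e := True)) j i - R (X(?e := False)) j i))"
    using p ij False by (subst expectation_bern_by_parts) (auto intro: edge_mem)
  also have "avg (\<lambda>X. R (X(?e := True)) j i - R (X(?e := False)) j i) = - of_real (1 / sqrt (real n)) * avg ?G"
  proof -
    have "R (X(?e := True)) j i - R (X(?e := False)) j i = - of_real (1 / sqrt (real n)) * ?G X" for X
      using R_flip[OF ij False ij(2,1), of X] by (simp add: algebra_simps)
    then show ?thesis by (simp del: of_real_divide)
  qed
  also have "of_real (1 / sqrt (real n)) * (v *\<^sub>R (- of_real (1 / sqrt (real n)) * avg ?G)) = - of_real (v / n) * avg ?G"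
  proof -
    have "of_real (1 / sqrt (real n)) * of_real (1 / sqrt (real n)) = (of_real (1 / n) :: complex)"
      using n by (simp flip: of_real_mult)
    then show ?thesis by (simp add: scaleR_conv_of_real field_simps)
  qed
  finally have eq: "avg (\<lambda>X. of_real (wigner p X i j / sqrt (real n)) * R X j i) = - of_real (v / n) * avg ?G" .
  have diff: "avg (\<lambda>X. (R X j j * R X i i + (R X j i)\<^sup>2) - ?G X) =
      avg (\<lambda>X. R X j j * R X i i + (R X j i)\<^sup>2) - avg ?G"
    by (rule Bochner_Integration.integral_diff) auto
  have "- c * g + c * a = c * (a - g)" for a c g :: complex by (simp add: algebra_simps)
  then have eq1: "avg (\<lambda>X. of_real (wigner p X i j / sqrt (real n)) * R X j i)
     + of_real (v / n) * avg (\<lambda>X. R X j j * R X i i + (R X j i)\<^sup>2)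
     = of_real (v / n) * avg (\<lambda>X. (R X j j * R X i i + (R X j i)\<^sup>2) - ?G X)"
    unfolding eq diff .
  have le1: "cmod (avg (\<lambda>X. (R X j j * R X i i + (R X j i)\<^sup>2) - ?G X)) \<le> 2 * (\<delta> / t)"
  proof -
    have "cmod (avg (\<lambda>X. (R X j j * R X i i + (R X j i)\<^sup>2) - ?G X))
       \<le> avg (\<lambda>X. cmod ((R X j j * R X i i + (R X j i)\<^sup>2) - ?G X))" by (rule integral_norm_bound)
    also have "\<dots> \<le> avg (\<lambda>X. 2 * (\<delta> / t))"
    proof (rule integral_mono)
      fix X
      have "cmod ((R X j j * R X i i + (R X j i)\<^sup>2) - ?G X) = cmod
        ((R (X(?e := False)) j j * R (X(?e := True)) i i - R X j j * R X i i) +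
         (R (X(?e := False)) j i * R (X(?e := True)) j i - R X j i * R X j i))"
        by (subst norm_minus_commute) (simp add: power2_eq_square algebra_simps)
      also have "\<dots> \<le> \<delta> / t + \<delta> / t"
        using ij False by (intro norm_triangle_le add_mono R_product_flip_le) auto
      finally show "cmod ((R X j j * R X i i + (R X j i)\<^sup>2) - ?G X) \<le> 2 * (\<delta> / t)"
        by (simp only: mult_2)
    qed auto
    finally show ?thesis by simp
  qed
  have vn: "\<bar>v / n\<bar> = v / n" using v by simp
  show ?thesis
    unfolding eq1 norm_mult norm_of_real vn if_not_P[OF False] add_0_right
    by (rule mult_left_mono[OF le1]) (use v in simp)
qed

lemma trace_M_R:
  "(\<Sum>i<n. \<Sum>j<n. of_real (wigner p X i j / sqrt (real n)) * R X j i)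
    = of_nat n * (1 + \<i> * of_real t * stieltjes X)"
proof -
  have "(\<Sum>i<n. \<Sum>j<n. of_real (wigner p X i j / sqrt (real n)) * R X j i) = (\<Sum>i<n. 1 + \<i> * of_real t * R X i i)"
    unfolding R_def using mult_resolvent[OF dec t] by (intro sum.cong refl) simp
  then show ?thesis using n
    by (simp add: sum.distrib sum_distrib_left[symmetric] stieltjes_def field_simps)
qed

text \<open>
  Summing the previous estimate over all entries turns \<open>\<Sum> R\<^sub>j\<^sub>j R\<^sub>i\<^sub>i\<close> into \<open>(n m)\<^sup>2\<close>, while
  \<open>\<Sum> R\<^sub>j\<^sub>i\<^sup>2\<close> is of lower order by the row norm bound.
\<close>

lemma loop_equation:
  "cmod (1 + \<i> * of_real t * avg stieltjes + of_real v * avg (\<lambda>X. (stieltjes X)\<^sup>2))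
    \<le> 4 / (sqrt (real n) * t ^ 3) + 3 / (n * t\<^sup>2)"
proof -
  let ?A = "\<lambda>i j. avg (\<lambda>X. of_real (wigner p X i j / sqrt (real n)) * R X j i)"
  let ?B = "\<lambda>i j. avg (\<lambda>X. R X j j * R X i i + (R X j i)\<^sup>2)"
  let ?S = "avg (\<lambda>X. \<Sum>i<n. \<Sum>j<n. (R X j i)\<^sup>2)"
  have A: "(\<Sum>i<n. \<Sum>j<n. ?A i j) = of_nat n * (1 + \<i> * of_real t * avg stieltjes)"
  proof -
    have "(\<Sum>i<n. \<Sum>j<n. ?A i j) = avg (\<lambda>X. \<Sum>i<n. \<Sum>j<n. of_real (wigner p X i j / sqrt (real n)) * R X j i)"
      by (simp add: Bochner_Integration.integral_sum del: of_real_divide)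
    also have "\<dots> = of_nat n * (1 + \<i> * of_real t * avg stieltjes)"
      unfolding trace_M_R by simp
    finally show ?thesis .
  qed
  have B: "(\<Sum>i<n. \<Sum>j<n. ?B i j) = (of_nat n)\<^sup>2 * avg (\<lambda>X. (stieltjes X)\<^sup>2) + ?S"
  proof -
    have "(\<Sum>i<n. \<Sum>j<n. ?B i j) = avg (\<lambda>X. \<Sum>i<n. \<Sum>j<n. R X j j * R X i i + (R X j i)\<^sup>2)"
      by (simp add: Bochner_Integration.integral_sum)
    also have "\<dots> = avg (\<lambda>X. (of_nat n)\<^sup>2 * (stieltjes X)\<^sup>2 + (\<Sum>i<n. \<Sum>j<n. (R X j i)\<^sup>2))"
    proof (intro arg_cong[where f = avg] ext)
      fix X
      have "(of_nat n * stieltjes X)\<^sup>2 = (\<Sum>i<n. \<Sum>j<n. R X j j * R X i i)"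
        using n by (simp add: stieltjes_def power2_eq_square sum_product mult.commute)
      then show "(\<Sum>i<n. \<Sum>j<n. R X j j * R X i i + (R X j i)\<^sup>2) =
        (of_nat n)\<^sup>2 * (stieltjes X)\<^sup>2 + (\<Sum>i<n. \<Sum>j<n. (R X j i)\<^sup>2)"
        by (simp add: sum.distrib power_mult_distrib)
    qed
    finally show ?thesis by simp
  qed
  have S: "cmod ?S \<le> n / t\<^sup>2"
  proof -
    have "cmod ?S \<le> avg (\<lambda>X. cmod (\<Sum>i<n. \<Sum>j<n. (R X j i)\<^sup>2))" by (rule integral_norm_bound)
    also have "\<dots> \<le> avg (\<lambda>X. n / t\<^sup>2)"
    proof (rule integral_mono)
      fix X
      have "cmod (\<Sum>i<n. \<Sum>j<n. (R X j i)\<^sup>2) \<le> (\<Sum>i<n. 1 / t\<^sup>2)"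
      proof (rule order_trans[OF norm_sum sum_mono])
        fix i assume "i \<in> {..<n}"
        then show "cmod (\<Sum>j<n. (R X j i)\<^sup>2) \<le> 1 / t\<^sup>2"
          using resolvent_product_sum_norm[OF dec dec t, of i i X X]
          by (simp add: R_def power2_eq_square resolvent_sym[of _ _ _ _ i])
      qed
      then show "cmod (\<Sum>i<n. \<Sum>j<n. (R X j i)\<^sup>2) \<le> n / t\<^sup>2" by simp
    qed auto
    finally show ?thesis by simp
  qed
  let ?L = "1 + \<i> * of_real t * avg stieltjes + of_real v * avg (\<lambda>X. (stieltjes X)\<^sup>2)"
  have "of_nat n * ?L = (\<Sum>i<n. \<Sum>j<n. ?A i j + of_real (v / n) * ?B i j) - of_real (v / n) * ?S"
  proof -
    have "(\<Sum>i<n. \<Sum>j<n. ?A i j + of_real (v / n) * ?B i j) = 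
      (\<Sum>i<n. \<Sum>j<n. ?A i j) + of_real (v / n) * (\<Sum>i<n. \<Sum>j<n. ?B i j)"
      by (simp only: sum.distrib sum_distrib_left)
    then show ?thesis unfolding A B using n by (simp add: field_simps power2_eq_square)
  qed
  moreover have "real n * cmod z = cmod w" if "of_nat n * z = w" for z w :: complex
    using that by (auto simp: norm_mult)
  ultimately have "real n * cmod ?L = cmod ((\<Sum>i<n. \<Sum>j<n. ?A i j + of_real (v / n) * ?B i j) - of_real (v / n) * ?S)"
    by blast
  also have "\<dots> \<le> cmod (\<Sum>i<n. \<Sum>j<n. ?A i j + of_real (v / n) * ?B i j) + cmod (of_real (v / n) * ?S)"
    by (rule norm_triangle_ineq4)
  also have "cmod (of_real (v / n) * ?S) \<le> 1 / n * (n / t\<^sup>2)"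
    unfolding norm_mult norm_of_real using v S by (intro mult_mono) (auto simp: divide_simps)
  also have "cmod (\<Sum>i<n. \<Sum>j<n. ?A i j + of_real (v / n) * ?B i j) \<le>
      (\<Sum>i<n. \<Sum>j<n. 1 / n * (2 * (\<delta> / t)) + (if i = j then 1 / n * (2 / t\<^sup>2) else 0))"
  proof (intro order_trans[OF norm_sum sum_mono] order_trans[OF norm_sum sum_mono])
    fix i j assume ij: "i \<in> {..<n}" "j \<in> {..<n}"
    have "v / n * x \<le> 1 / n * x" if "0 \<le> x" for x
      using v that by (intro mult_right_mono divide_right_mono) auto
    note v_le = this
    have "cmod (?A i j + of_real (v / n) * ?B i j) \<le>
        v / n * (2 * (\<delta> / t)) + (if i = j then v / n * (2 / t\<^sup>2) else 0)"
      using ij by (intro entry_times_resolvent) auto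
    also have "\<dots> \<le> 1 / n * (2 * (\<delta> / t)) + (if i = j then 1 / n * (2 / t\<^sup>2) else 0)"
    proof (rule add_mono)
      show "v / n * (2 * (\<delta> / t)) \<le> 1 / n * (2 * (\<delta> / t))" by (rule v_le) (use t in simp)
      show "(if i = j then v / n * (2 / t\<^sup>2) else 0) \<le> (if i = j then 1 / n * (2 / t\<^sup>2) else 0)"
        using v_le[of "2 / t\<^sup>2"] by (cases "i = j") (simp_all only: if_True if_False order_refl, simp)
    qed
    finally show "cmod (?A i j + of_real (v / n) * ?B i j) \<le> 1 / n * (2 * (\<delta> / t)) + (if i = j then 1 / n * (2 / t\<^sup>2) else 0)" .
  qed
  also have "\<dots> = n * (2 * (\<delta> / t)) + 2 / t\<^sup>2"
    using n by (simp add: sum.distrib distrib_left)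
  finally have "real n * cmod ?L \<le> n * (2 * (\<delta> / t)) + 2 / t\<^sup>2 + 1 / n * (n / t\<^sup>2)" by simp
  then have "cmod ?L \<le> (n * (2 * (\<delta> / t)) + 2 / t\<^sup>2 + 1 / n * (n / t\<^sup>2)) / n"
    using n by (simp add: field_simps)
  also have "\<dots> = 4 / (sqrt (real n) * t ^ 3) + 3 / (n * t\<^sup>2)"
    using n t by (simp add: field_simps power2_eq_square power3_eq_cube)
  finally show ?thesis .
qed

text \<open>
  The change of the trace is a sum over products of two resolvents, so the row norm bound replaces
  the factor \<open>n\<close> that a bound on single entries would cost.
\<close>

lemma stieltjes_flip_le:
  assumes "e \<in> all_edges n"
  shows "cmod (stieltjes (X(e := True)) - stieltjes (X(e := False))) \<le> \<delta> / n"
proof -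
  obtain i j where ij: "i < n" "j < n" "i \<noteq> j" and e: "e = {i, j}" using assms by (rule all_edgesE)
  let ?F = "X(e := False)" and ?T = "X(e := True)"
  have "stieltjes ?F - stieltjes ?T = (\<Sum>a<n. R ?F a a - R ?T a a) / of_nat n"
    by (simp add: stieltjes_def sum_subtractf diff_divide_distrib)
  also have "(\<Sum>a<n. R ?F a a - R ?T a a) =
     of_real (1 / sqrt (real n)) * ((\<Sum>a<n. R ?F a i * R ?T j a) + (\<Sum>a<n. R ?F a j * R ?T i a))"
    unfolding e using R_flip[OF ij] by (simp add: sum.distrib add_divide_distrib flip: sum_divide_distrib)
  finally have eq: "stieltjes ?F - stieltjes ?T = of_real (1 / sqrt (real n)) *
    ((\<Sum>a<n. R ?F a i * R ?T j a) + (\<Sum>a<n. R ?F a j * R ?T i a)) / of_nat n" .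
  have "cmod (stieltjes ?F - stieltjes ?T) =
     1 / sqrt (real n) * cmod ((\<Sum>a<n. R ?F a i * R ?T j a) + (\<Sum>a<n. R ?F a j * R ?T i a)) / n"
    unfolding eq by (simp add: norm_mult norm_divide)
  also have "\<dots> \<le> 1 / sqrt (real n) * (1 / t\<^sup>2 + 1 / t\<^sup>2) / n"
    unfolding R_def using ij
    by (intro divide_right_mono mult_left_mono norm_triangle_le add_mono
      resolvent_product_sum_norm[OF dec dec t]) auto
  also have "\<dots> = \<delta> / n" by simp
  finally show ?thesis by (simp add: norm_minus_commute)
qed

lemma variance_stieltjes:
  "avg (\<lambda>X. (Re (stieltjes X) - Re (avg stieltjes))\<^sup>2) \<le> 4 / (n * t ^ 4)"
  "avg (\<lambda>X. (Im (stieltjes X) - Im (avg stieltjes))\<^sup>2) \<le> 4 / (n * t ^ 4)"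
proof -
  have var: "avg (\<lambda>X. (f X - avg f)\<^sup>2) \<le> 4 / (n * t ^ 4)"
    if f: "\<And>X e. e \<in> all_edges n \<Longrightarrow> \<bar>f (X(e := True)) - f (X(e := False))\<bar> \<le> \<delta> / n" for f
  proof -
    have "avg (\<lambda>X. (f X - avg f)\<^sup>2) \<le> v * (\<Sum>e\<in>all_edges n. (\<delta> / n)\<^sup>2)"
      using p f by (intro variance_bern_bounded_differences) auto
    also have "\<dots> \<le> 1 * (\<Sum>e\<in>all_edges n. (\<delta> / n)\<^sup>2)"
      using v by (intro mult_right_mono sum_nonneg) auto
    also have "\<dots> \<le> real (n\<^sup>2) * (\<delta> / n)\<^sup>2"
      using card_all_edges_le[of n] by (simp del: of_nat_power power_divide add: mult_right_mono)
    also have "\<dots> = 4 / (n * t ^ 4)"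
      using n t by (simp add: field_simps power2_eq_square power4_eq_xxxx)
    finally show ?thesis .
  qed
  have "Re (avg stieltjes) = avg (\<lambda>X. Re (stieltjes X))" "Im (avg stieltjes) = avg (\<lambda>X. Im (stieltjes X))"
    by (simp_all add: integral_Re integral_Im)
  then show "avg (\<lambda>X. (Re (stieltjes X) - Re (avg stieltjes))\<^sup>2) \<le> 4 / (n * t ^ 4)"
    and "avg (\<lambda>X. (Im (stieltjes X) - Im (avg stieltjes))\<^sup>2) \<le> 4 / (n * t ^ 4)"
    using var[of "\<lambda>X. Re (stieltjes X)"] var[of "\<lambda>X. Im (stieltjes X)"]
      order_trans[OF abs_Re_le_cmod stieltjes_flip_le] order_trans[OF abs_Im_le_cmod stieltjes_flip_le]
    by (simp_all del: fun_upd_apply)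
qed

lemma expected_stieltjes_quadratic:
  "cmod (1 + \<i> * of_real t * avg stieltjes + of_real v * (avg stieltjes)\<^sup>2)
    \<le> 4 / (sqrt (real n) * t ^ 3) + 3 / (n * t\<^sup>2) + 8 / (n * t ^ 4)"
proof -
  let ?m = "avg stieltjes"
  have eq: "avg (\<lambda>X. (stieltjes X)\<^sup>2) - ?m\<^sup>2 = avg (\<lambda>X. (stieltjes X - ?m)\<^sup>2)"
  proof -
    have "avg (\<lambda>X. (stieltjes X - ?m)\<^sup>2) = avg (\<lambda>X. (stieltjes X)\<^sup>2 - 2 * ?m * stieltjes X + ?m\<^sup>2)"
      by (simp add: power2_eq_square algebra_simps)
    then show ?thesis by (simp add: power2_eq_square)
  qed
  have "cmod (avg (\<lambda>X. (stieltjes X - ?m)\<^sup>2)) \<le> avg (\<lambda>X. cmod ((stieltjes X - ?m)\<^sup>2))"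
    by (rule integral_norm_bound)
  also have "\<dots> = avg (\<lambda>X. (Re (stieltjes X) - Re ?m)\<^sup>2) + avg (\<lambda>X. (Im (stieltjes X) - Im ?m)\<^sup>2)"
    by (simp add: norm_power cmod_power2)
  also have "\<dots> \<le> 4 / (n * t ^ 4) + 4 / (n * t ^ 4)" by (intro add_mono variance_stieltjes)
  finally have 1: "cmod (avg (\<lambda>X. (stieltjes X)\<^sup>2) - ?m\<^sup>2) \<le> 8 / (n * t ^ 4)" unfolding eq by simp
  have "cmod (a + of_real v * b) \<le> B + D"
    if "cmod (a + of_real v * c) \<le> B" "cmod (c - b) \<le> D" for a b c B D
  proof -
    have "a + of_real v * b = (a + of_real v * c) - of_real v * (c - b)"
      by (simp add: algebra_simps)
    then have "cmod (a + of_real v * b) \<le> cmod (a + of_real v * c) + cmod (of_real v * (c - b))"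
      by (metis norm_triangle_ineq4)
    also have "cmod (of_real v * (c - b)) \<le> 1 * cmod (c - b)"
      unfolding norm_mult norm_of_real using v by (intro mult_right_mono) auto
    finally show ?thesis using that by linarith
  qed
  from this[OF loop_equation 1] show ?thesis .
qed

lemma Im_stieltjes: "Im (stieltjes X) = (\<Sum>k<n. t / ((l X k)\<^sup>2 + t\<^sup>2)) / n"
proof -
  have "stieltjes X = (\<Sum>k<n. 1 / Complex (l X k) (- t)) / of_nat n"
    unfolding stieltjes_def R_def resolvent_trace[OF dec] ..
  also have "Im \<dots> = (\<Sum>k<n. Im (1 / Complex (l X k) (- t))) / n"
    by (simp only: Im_divide_of_nat Im_sum)
  also have "\<dots> = (\<Sum>k<n. t / ((l X k)\<^sup>2 + t\<^sup>2)) / n" by (simp add: Im_divide power2_eq_square)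
  finally show ?thesis .
qed

text \<open>
  The quadratic factors as \<open>(z - is)(vz + i(vs + t))\<close>, and in the upper half plane the second factor
  has modulus at least \<open>t\<close>. So a small value of the quadratic at \<open>E m\<close> puts \<open>E m\<close>
  close to \<open>is\<close>, and the variance bound transfers this to \<open>m\<close>.
\<close>

theorem Im_stieltjes_converges:
  assumes s: "0 \<le> s" "v * s\<^sup>2 + t * s = 1"
  shows "avg (\<lambda>X. \<bar>Im (stieltjes X) - s\<bar>) \<le>
    (4 / (sqrt (real n) * t ^ 3) + 3 / (n * t\<^sup>2) + 8 / (n * t ^ 4)) / t + sqrt (4 / (n * t ^ 4))"
proof -
  let ?m = "avg stieltjes"
  let ?b = "4 / (sqrt (real n) * t ^ 3) + 3 / (n * t\<^sup>2) + 8 / (n * t ^ 4)"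
  have Im0: "0 \<le> Im ?m"
  proof -
    have "Im ?m = avg (\<lambda>X. Im (stieltjes X))" by (simp add: integral_Im)
    also have "0 \<le> \<dots>" unfolding Im_stieltjes using t by (intro Bochner_Integration.integral_nonneg) (auto intro!: divide_nonneg_nonneg sum_nonneg)
    finally show ?thesis .
  qed
  have v0: "of_real v \<noteq> (0 :: complex)" using v by (metis less_irrefl of_real_eq_0_iff)
  have fac: "1 + \<i> * of_real t * ?m + of_real v * ?m\<^sup>2 = 
    (?m - \<i> * of_real s) * (of_real v * ?m + \<i> * of_real (v * s + t))"
  proof -
    have "(?m - \<i> * of_real s) * (of_real v * ?m + \<i> * of_real (v * s + t)) =
      of_real v * ?m\<^sup>2 + \<i> * of_real t * ?m + of_real (v * s\<^sup>2 + t * s)"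
      by (simp add: algebra_simps power2_eq_square)
    then show ?thesis using s by simp
  qed
  have "t \<le> v * Im ?m + (v * s + t)" using v s Im0 by simp
  also have "\<dots> = Im (of_real v * ?m + \<i> * of_real (v * s + t))" by simp
  also have "\<dots> \<le> cmod (of_real v * ?m + \<i> * of_real (v * s + t))" using abs_Im_le_cmod by (rule order_trans[OF abs_ge_self])
  finally have "cmod (?m - \<i> * of_real s) * t \<le> cmod (1 + \<i> * of_real t * ?m + of_real v * ?m\<^sup>2)"
    unfolding fac norm_mult by (intro mult_left_mono) auto
  also have "\<dots> \<le> ?b" by (rule expected_stieltjes_quadratic)
  finally have "cmod (?m - \<i> * of_real s) \<le> ?b / t" using t by (simp add: pos_le_divide_eq)
  moreover have "\<bar>Im ?m - s\<bar> \<le> cmod (?m - \<i> * of_real s)" using abs_Im_le_cmod[of "?m - \<i> * of_real s"] by simp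
  ultimately have 1: "\<bar>Im ?m - s\<bar> \<le> ?b / t" by linarith
  let ?f = "\<lambda>X. \<bar>Im (stieltjes X) - Im ?m\<bar>"
  have "(avg ?f)\<^sup>2 \<le> avg (\<lambda>X. (?f X)\<^sup>2)"
  proof -
    have "0 \<le> measure_pmf.variance (bern_prod (all_edges n) p) ?f"
      by (intro Bochner_Integration.integral_nonneg) auto
    then show ?thesis by (subst (asm) measure_pmf.variance_eq) auto
  qed
  also have "\<dots> \<le> 4 / (n * t ^ 4)" using variance_stieltjes(2) by simp
  finally have 2: "avg ?f \<le> sqrt (4 / (n * t ^ 4))" by (rule real_le_rsqrt)
  have "avg (\<lambda>X. \<bar>Im (stieltjes X) - s\<bar>) \<le> avg (\<lambda>X. ?f X + \<bar>Im ?m - s\<bar>)"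
    by (intro integral_mono) auto
  also have "\<dots> = avg ?f + \<bar>Im ?m - s\<bar>" by simp
  finally show ?thesis using 1 2 by linarith
qed

end

section \<open>Absolute values as integrals over the imaginary axis\<close>

lemma integral_Ioi_FTC:
  fixes f F :: "real \<Rightarrow> real"
  assumes f: "\<And>x. 0 < x \<Longrightarrow> DERIV F x :> f x" "\<And>x. 0 < x \<Longrightarrow> isCont f x" "\<And>x. 0 < x \<Longrightarrow> 0 \<le> f x"
    and F: "(F \<longlongrightarrow> A) (at_right 0)" "(F \<longlongrightarrow> B) at_top"
  shows "set_integrable lborel {0<..} f" "(LBINT x:{0<..}. f x) = B - A"
proof -
  have e: "einterval 0 \<infinity> = {0<..}" by (auto simp: einterval_def)
  have F0: "((F \<circ> real_of_ereal) \<longlongrightarrow> A) (at_right (ereal 0))"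
    unfolding ereal_tendsto_simps by (rule F)
  have Fi: "((F \<circ> real_of_ereal) \<longlongrightarrow> B) (at_left \<infinity>)"
    unfolding ereal_tendsto_simps by (rule F)
  have *: "set_integrable lborel (einterval (ereal 0) \<infinity>) f" "(LBINT x=ereal 0..\<infinity>. f x) = B - A"
    using F0 Fi by (intro interval_integral_FTC_nonneg[where F = F]; auto intro: f AE_I2)+
  show "set_integrable lborel {0<..} f" "(LBINT x:{0<..}. f x) = B - A"
    using * e by (auto simp: interval_lebesgue_integral_def zero_ereal_def)
qed

text \<open>
  The antiderivative is \<open>\<bar>x\<bar> arctan(t/\<bar>x\<bar>)\<close>.
\<close>

lemma abs_as_integral:
  "set_integrable lborel {0<..} (\<lambda>t :: real. x\<^sup>2 / (x\<^sup>2 + t\<^sup>2))"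
  "(LBINT t:{0<..}. x\<^sup>2 / (x\<^sup>2 + t\<^sup>2)) = pi / 2 * \<bar>x\<bar>"
proof -
  have "set_integrable lborel {0<..} (\<lambda>t :: real. x\<^sup>2 / (x\<^sup>2 + t\<^sup>2)) \<and>
    (LBINT t:{0<..}. x\<^sup>2 / (x\<^sup>2 + t\<^sup>2)) = pi / 2 * \<bar>x\<bar>"
  proof (cases "x = 0")
    case True
    then show ?thesis by (simp add: set_integrable_def set_lebesgue_integral_def)
  next
    case False
    define a where "a = \<bar>x\<bar>"
    have a: "a > 0" and xa: "x\<^sup>2 = a\<^sup>2" using False by (auto simp: a_def)
    have pos: "a\<^sup>2 + t\<^sup>2 > 0" for t using a by (simp add: add_pos_nonneg)
    let ?F = "\<lambda>t :: real. a * arctan (t / a)"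
    have D: "DERIV ?F t :> a\<^sup>2 / (a\<^sup>2 + t\<^sup>2)" for t
      using a pos[of t] by (auto intro!: derivative_eq_intros simp: field_simps power2_eq_square)
    have C: "isCont (\<lambda>t. a\<^sup>2 / (a\<^sup>2 + t\<^sup>2)) t" for t
      using pos[of t] by (intro continuous_intros) auto
    have 0: "(?F \<longlongrightarrow> 0) (at_right 0)"
    proof -
      have "isCont ?F 0" using a by (intro continuous_intros) auto
      then show ?thesis by (simp add: isCont_def filterlim_at_split)
    qed
    have i: "(?F \<longlongrightarrow> a * (pi / 2)) at_top"
      by (intro tendsto_mult tendsto_const filterlim_compose[OF tendsto_arctan_at_top])
        (use a in real_asymp)
    show ?thesis unfolding xa a_def[symmetric]
      using integral_Ioi_FTC[OF D C _ 0 i] pos by (auto simp: less_imp_le mult.commute)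
  qed
  then show "set_integrable lborel {0<..} (\<lambda>t :: real. x\<^sup>2 / (x\<^sup>2 + t\<^sup>2))"
    "(LBINT t:{0<..}. x\<^sup>2 / (x\<^sup>2 + t\<^sup>2)) = pi / 2 * \<bar>x\<bar>" by auto
qed

text \<open>
  The imaginary part at \<open>it\<close> of the Stieltjes transform of the semicircle law with variance \<open>v\<close>.
\<close>

definition semicircle_stieltjes :: "real \<Rightarrow> real \<Rightarrow> real" where
  "semicircle_stieltjes v t = (sqrt (t\<^sup>2 + 4 * v) - t) / (2 * v)"

lemma semicircle_quadratic:
  assumes "0 < v" "0 < t"
  shows "0 \<le> semicircle_stieltjes v t" "v * (semicircle_stieltjes v t)\<^sup>2 + t * semicircle_stieltjes v t = 1"
proof -
  have "sqrt (t\<^sup>2) \<le> sqrt (t\<^sup>2 + 4 * v)" using assms by (intro real_sqrt_le_mono) auto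
  then show "0 \<le> semicircle_stieltjes v t" using assms by (simp add: semicircle_stieltjes_def)
  define q where "q = sqrt (t\<^sup>2 + 4 * v)"
  have "q\<^sup>2 = t\<^sup>2 + 4 * v" using assms by (simp add: q_def)
  then show "v * (semicircle_stieltjes v t)\<^sup>2 + t * semicircle_stieltjes v t = 1"
    unfolding semicircle_stieltjes_def q_def[symmetric] using assms
    by (simp add: field_simps power2_eq_square)
qed

text \<open>
  By the integral representation of \<open>\<bar>x\<bar>\<close>, this is \<open>\<pi>/2\<close> times the first absolute moment
  \<open>8/(3\<pi>) \<surd>v\<close> of the semicircle law. The integrand has the elementary antiderivative
  \<open>t + (t\<^sup>3 - (t\<^sup>2 + 4v)\<^sup>3\<^sup>/\<^sup>2)/(6v)\<close>, which vanishes at infinity.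
\<close>

lemma semicircle_integral:
  assumes v: "0 < v"
  shows "set_integrable lborel {0<..} (\<lambda>t. 1 - t * semicircle_stieltjes v t)"
    "(LBINT t:{0<..}. 1 - t * semicircle_stieltjes v t) = 4 / 3 * sqrt v"
proof -
  let ?q = "\<lambda>t. sqrt (t\<^sup>2 + 4 * v)"
  have pos: "0 < t\<^sup>2 + 4 * v" for t using v by (simp add: add_nonneg_pos)
  let ?F = "\<lambda>t. t + t ^ 3 / (6 * v) - ?q t ^ 3 / (6 * v)"
  have D: "DERIV ?F t :> 1 - t * semicircle_stieltjes v t" for t
  proof -
    have q: "?q t > 0" using pos by simp
    have "DERIV ?q t :> t / ?q t"
      using pos[of t] by (auto intro!: derivative_eq_intros simp: field_simps)
    from DERIV_power[OF this, of 3] have "DERIV (\<lambda>t. ?q t ^ 3) t :> 3 * (?q t)\<^sup>2 * (t / ?q t)"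
      by (simp add: mult_ac)
    from DERIV_cdivide[OF this, of "6 * v"] have "DERIV (\<lambda>t. ?q t ^ 3 / (6 * v)) t :> 3 * (?q t)\<^sup>2 * (t / ?q t) / (6 * v)" .
    moreover have "DERIV (\<lambda>t. t + t ^ 3 / (6 * v)) t :> 1 + 3 * t\<^sup>2 / (6 * v)"
      using v by (auto intro!: derivative_eq_intros)
    ultimately have D: "DERIV ?F t :> 1 + 3 * t\<^sup>2 / (6 * v) - 3 * (?q t)\<^sup>2 * (t / ?q t) / (6 * v)"
      by (intro DERIV_diff)
    have eq: "1 + 3 * t\<^sup>2 / (6 * v) - 3 * r\<^sup>2 * (t / r) / (6 * v) = 1 - t * ((r - t) / (2 * v))"
      if "r > 0" for r
      using v that by (simp add: field_simps power2_eq_square)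
    from D show ?thesis unfolding semicircle_stieltjes_def eq[OF q] .
  qed
  have C: "isCont (\<lambda>t. 1 - t * semicircle_stieltjes v t) t" for t
    unfolding semicircle_stieltjes_def using v by (intro continuous_intros) auto
  have nn: "0 \<le> 1 - t * semicircle_stieltjes v t" if "0 < t" for t
    using semicircle_quadratic[OF v that] v by (simp add: algebra_simps) (smt (verit) mult_nonneg_nonneg zero_le_power2)
  have 0: "(?F \<longlongrightarrow> ?F 0) (at_right 0)"
  proof -
    have "isCont ?F 0" using v by (intro continuous_intros) auto
    then show ?thesis unfolding isCont_def by (simp only: filterlim_at_split)
  qed
  have i: "(?F \<longlongrightarrow> 0) at_top" using v by real_asymp
  have F0: "0 - ?F 0 = 4 / 3 * sqrt v"
  proof -
    have "sqrt (4 * v) ^ 3 = 8 * (v * sqrt v)"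
      using v by (simp add: real_sqrt_mult power3_eq_cube)
    then show ?thesis using v by simp
  qed
  show "set_integrable lborel {0<..} (\<lambda>t. 1 - t * semicircle_stieltjes v t)"
    "(LBINT t:{0<..}. 1 - t * semicircle_stieltjes v t) = 4 / 3 * sqrt v"
    using integral_Ioi_FTC[OF D C nn 0 i] F0 by auto
qed

lemma dominator_integrable: "set_integrable lborel {0<..} (\<lambda>t :: real. 1 / (1 + t\<^sup>2))"
  using abs_as_integral(1)[of 1] by simp

section \<open>The energy of the centred adjacency matrix\<close>

lemma sum_eigenvalue_squares:
  assumes "eigen_decomp n M l u"
  shows "(\<Sum>k<n. (l k)\<^sup>2) = (\<Sum>i<n. \<Sum>j<n. (M i j)\<^sup>2)"
proof -
  have u: "orthonormal n (\<lambda>j k. u k j)" and u': "orthonormal n u"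
    using assms by (auto simp: eigen_decomp_def orthonormal_def mult.commute)
  have "(\<Sum>i<n. \<Sum>j<n. (M i j)\<^sup>2) = (\<Sum>i<n. \<Sum>j<n. (\<Sum>k<n. u k j * (l k * u k i))\<^sup>2)"
    using assms by (simp add: eigen_decomp_def mult_ac)
  also have "\<dots> = (\<Sum>i<n. \<Sum>k<n. (l k)\<^sup>2 * (u k i * u k i))"
    unfolding parseval[OF u] by (simp add: power2_eq_square mult_ac)
  also have "\<dots> = (\<Sum>k<n. (l k)\<^sup>2 * (\<Sum>i<n. u k i * u k i))"
    by (subst sum.swap) (simp add: sum_distrib_left)
  also have "\<dots> = (\<Sum>k<n. (l k)\<^sup>2)" using u' by (simp add: orthonormal_def)
  finally show ?thesis ..
qed

lemma set_integral_finite_sum: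
  fixes f :: "'i \<Rightarrow> real \<Rightarrow> real"
  assumes "\<And>i. i \<in> I \<Longrightarrow> set_integrable M A (f i)"
  shows "set_integrable M A (\<lambda>x. \<Sum>i\<in>I. f i x)"
    "(LINT x:A|M. \<Sum>i\<in>I. f i x) = (\<Sum>i\<in>I. LINT x:A|M. f i x)"
  using assms unfolding set_integrable_def set_lebesgue_integral_def
  by (simp_all add: sum_distrib_left Bochner_Integration.integral_sum)

lemma set_integral_bern_exp:
  fixes h :: "('a \<Rightarrow> bool) \<Rightarrow> real \<Rightarrow> real"
  assumes S: "finite S" and h: "\<And>X. set_integrable lborel A (h X)"
  shows "set_integrable lborel A (\<lambda>t. bern_exp S p (\<lambda>X. h X t))"
    "(LBINT t:A. bern_exp S p (\<lambda>X. h X t)) = bern_exp S p (\<lambda>X. LBINT t:A. h X t)"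
proof -
  let ?P = "bern_prod S p"
  have E: "bern_exp S p f = (\<Sum>X\<in>set_pmf ?P. pmf ?P X * f X)" for f :: "_ \<Rightarrow> real"
    using S by (subst integral_measure_pmf[of "set_pmf ?P"]) auto
  show "set_integrable lborel A (\<lambda>t. bern_exp S p (\<lambda>X. h X t))"
    unfolding E by (intro set_integral_finite_sum set_integrable_mult_right) (auto simp: S h)
  show "(LBINT t:A. bern_exp S p (\<lambda>X. h X t)) = bern_exp S p (\<lambda>X. LBINT t:A. h X t)"
    unfolding E by (subst set_integral_finite_sum(2)) (auto simp: S h)
qed

text \<open>
  The integral representation of \<open>\<bar>x\<bar>\<close> reduces the claim to convergence, for each fixed \<open>t\<close>, of
  \<open>1 - t Im m(it)\<close> to \<open>1 - ts\<close>. The mean square of the eigenvalues of \<open>W/\<surd>n\<close> is at most one for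
  every graph, which bounds the first of these functions by the integrable \<open>2/(1 + t\<^sup>2)\<close>.
\<close>

theorem wigner_energy_limit:
  assumes p: "0 < p" "p < 1"
  shows "(\<lambda>n. bern_exp (all_edges n) p (\<lambda>X.
      \<bar>mat_energy n (wigner p X) / (n * sqrt n) - 8 / (3 * pi) * sqrt (p * (1 - p))\<bar>)) \<longlonglongrightarrow> 0"
proof -
  let ?v = "p * (1 - p)"
  have v: "?v > 0" using p by simp
  let ?M = "\<lambda>n X i j. wigner p X i j / sqrt (real n)"
  have "\<forall>n X. \<exists>l u. eigen_decomp n (?M n X) l u"
    by (intro allI eigen_decomp_exists) (simp add: wigner_sym)
  then obtain l u where dec: "\<And>n X. eigen_decomp n (?M n X) (l n X) (u n X)" by metis
  define g where "g = (\<lambda>n X t. (\<Sum>k<n. (l n X k)\<^sup>2 / ((l n X k)\<^sup>2 + t\<^sup>2)) / real n)"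
  define h where "h = (\<lambda>t. 1 - t * semicircle_stieltjes ?v t)"
  define F where "F = (\<lambda>n t. bern_exp (all_edges n) p (\<lambda>X. \<bar>g n X t - h t\<bar>))"
  define D where "D = (\<lambda>t :: real. 2 * (1 / (1 + t\<^sup>2)) + h t)"

  have h0: "0 \<le> h t" if "0 < t" for t
    using semicircle_quadratic[OF v that] v unfolding h_def
    by (smt (verit) mult_nonneg_nonneg zero_le_power2)
  have hi: "set_integrable lborel {0<..} h" "(LBINT t:{0<..}. h t) = 4 / 3 * sqrt ?v"
    unfolding h_def using semicircle_integral[OF v] by auto
  have gi: "set_integrable lborel {0<..} (g n X)" for n X
    unfolding g_def by (intro set_integrable_divide set_integral_finite_sum abs_as_integral)
  have gI: "(LBINT t:{0<..}. g n X t) = pi / 2 * (\<Sum>k<n. \<bar>l n X k\<bar>) / n" for n X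
    unfolding g_def
    by (simp add: set_integral_finite_sum abs_as_integral sum_distrib_left)
  have Di: "set_integrable lborel {0<..} D"
    unfolding D_def by (intro set_integral_add set_integrable_mult_right dominator_integrable hi)
  have g0: "0 \<le> g n X t" for n X t
    unfolding g_def by (intro divide_nonneg_nonneg sum_nonneg) auto
  \<comment> \<open>With \<open>y = l\<^sup>2\<close> and \<open>T = t\<^sup>2\<close>, both \<open>y/(y+T) \<le> 1\<close> and \<open>T y/(y+T) \<le> y\<close> hold;
    the mean of \<open>y\<close> is at most one, so adding the means bounds \<open>(1 + T) g\<close> by two.\<close>
  have gD: "g n X t \<le> 2 * (1 / (1 + t\<^sup>2))" if t: "0 < t" for n X t
  proof (cases "n = 0")
    case True
    then show ?thesis by (simp add: g_def)
  next
    case False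
    have ln: "(\<Sum>k<n. (l n X k)\<^sup>2) \<le> n"
    proof -
      have "(\<Sum>k<n. (l n X k)\<^sup>2) = (\<Sum>i<n. \<Sum>j<n. (?M n X i j)\<^sup>2)"
        by (rule sum_eigenvalue_squares[OF dec])
      also have "\<dots> \<le> (\<Sum>i<n. \<Sum>j<n. 1 / n)"
      proof (intro sum_mono)
        fix i j
        have "(wigner p X i j)\<^sup>2 \<le> 1"
          using p by (auto simp: wigner_def abs_square_le_1)
        then show "(?M n X i j)\<^sup>2 \<le> 1 / n" by (simp add: power_divide divide_right_mono)
      qed
      also have "\<dots> = n" using False by simp
      finally show ?thesis .
    qed
    have "(\<Sum>k<n. (l n X k)\<^sup>2 / ((l n X k)\<^sup>2 + t\<^sup>2)) + t\<^sup>2 * (\<Sum>k<n. (l n X k)\<^sup>2 / ((l n X k)\<^sup>2 + t\<^sup>2))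
       = (\<Sum>k<n. (1 + t\<^sup>2) * ((l n X k)\<^sup>2 / ((l n X k)\<^sup>2 + t\<^sup>2)))"
      by (simp only: distrib_right sum.distrib sum_distrib_left mult_1_left)
    also have "\<dots> \<le> (\<Sum>k<n. 1 + (l n X k)\<^sup>2)"
    proof (rule sum_mono)
      fix k
      have "y / (y + t\<^sup>2) \<le> 1" "t\<^sup>2 * (y / (y + t\<^sup>2)) \<le> y" if "0 \<le> y" for y
      proof -
        have "y + t\<^sup>2 > 0" using that t by (simp add: add_nonneg_pos)
        then show "y / (y + t\<^sup>2) \<le> 1" "t\<^sup>2 * (y / (y + t\<^sup>2)) \<le> y"
          using that t by (simp_all add: field_simps)
      qed
      from this[of "(l n X k)\<^sup>2"]
      show "(1 + t\<^sup>2) * ((l n X k)\<^sup>2 / ((l n X k)\<^sup>2 + t\<^sup>2)) \<le> 1 + (l n X k)\<^sup>2"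
        unfolding distrib_right mult_1_left by (intro add_mono) simp_all
    qed
    also have "\<dots> \<le> 2 * n" using ln by (simp add: sum.distrib)
    finally have "(1 + t\<^sup>2) * (\<Sum>k<n. (l n X k)\<^sup>2 / ((l n X k)\<^sup>2 + t\<^sup>2)) \<le> 2 * n"
      by (simp add: distrib_right)
    then show ?thesis unfolding g_def using False
      by (simp add: field_simps add_pos_nonneg)
  qed
  have FD: "\<bar>F n t\<bar> \<le> D t" if t: "0 < t" for n t
  proof -
    have "F n t \<le> bern_exp (all_edges n) p (\<lambda>X. D t)"
      unfolding F_def
    proof (rule integral_mono)
      fix X
      show "\<bar>g n X t - h t\<bar> \<le> D t"
        using g0[of n X t] gD[OF t, of n X] h0[OF t] unfolding D_def by linarith
    qed auto
    moreover have "0 \<le> F n t" unfolding F_def by (intro Bochner_Integration.integral_nonneg) auto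
    ultimately show ?thesis by simp
  qed
  have Flim: "(\<lambda>n. F n t) \<longlonglongrightarrow> 0" if t: "0 < t" for t
  proof -
    let ?B = "\<lambda>n. t * ((4 / (sqrt (real n) * t ^ 3) + 3 / (n * t\<^sup>2) + 8 / (n * t ^ 4)) / t + sqrt (4 / (n * t ^ 4)))"
    have le: "F n t \<le> ?B n" if n: "n > 0" for n
    proof -
      interpret wigner_resolvent n p t "l n" "u n"
        using n p t dec by unfold_locales auto
      have gs: "g n X t = 1 - t * Im (stieltjes X)" for X
      proof -
        have "g n X t = (\<Sum>k<n. 1 - t * (t / ((l n X k)\<^sup>2 + t\<^sup>2))) / n"
        proof -
          have "(l n X k)\<^sup>2 / ((l n X k)\<^sup>2 + t\<^sup>2) = 1 - t * (t / ((l n X k)\<^sup>2 + t\<^sup>2))" for k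
          proof -
            have "(l n X k)\<^sup>2 + t\<^sup>2 > 0" using t by (simp add: add_nonneg_pos)
            then have "(l n X k)\<^sup>2 / ((l n X k)\<^sup>2 + t\<^sup>2) + t\<^sup>2 / ((l n X k)\<^sup>2 + t\<^sup>2) = 1"
              using t by (simp flip: add_divide_distrib)
            moreover have "t * (t / ((l n X k)\<^sup>2 + t\<^sup>2)) = t\<^sup>2 / ((l n X k)\<^sup>2 + t\<^sup>2)"
              by (simp add: power2_eq_square)
            ultimately show ?thesis by linarith
          qed
          then show ?thesis unfolding g_def by simp
        qed
        also have "\<dots> = 1 - t * Im (stieltjes X)"
          unfolding Im_stieltjes using n
          by (simp only: sum_subtractf sum_distrib_left[symmetric]) (simp add: diff_divide_distrib)
        finally show ?thesis .
      qed
      have "F n t = avg (\<lambda>X. t * \<bar>Im (stieltjes X) - semicircle_stieltjes ?v t\<bar>)"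
        unfolding F_def gs h_def
      proof (intro Bochner_Integration.integral_cong refl)
        fix X
        have "1 - t * Im (stieltjes X) - (1 - t * semicircle_stieltjes ?v t) = - (t * (Im (stieltjes X) - semicircle_stieltjes ?v t))"
          by (simp add: algebra_simps)
        then show "\<bar>1 - t * Im (stieltjes X) - (1 - t * semicircle_stieltjes ?v t)\<bar> = t * \<bar>Im (stieltjes X) - semicircle_stieltjes ?v t\<bar>"
          using t by (simp add: abs_mult)
      qed
      also have "\<dots> = t * avg (\<lambda>X. \<bar>Im (stieltjes X) - semicircle_stieltjes ?v t\<bar>)" by simp
      also have "\<dots> \<le> ?B n"
        using t by (intro mult_left_mono Im_stieltjes_converges semicircle_quadratic v) auto
      finally show ?thesis .
    qed
    have B: "?B \<longlonglongrightarrow> 0" using t by real_asymp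
    show ?thesis
    proof (rule tendsto_sandwich[OF _ _ tendsto_const B])
      show "\<forall>\<^sub>F n in sequentially. 0 \<le> F n t"
        unfolding F_def by (intro always_eventually allI Bochner_Integration.integral_nonneg) auto
      show "\<forall>\<^sub>F n in sequentially. F n t \<le> ?B n"
        using eventually_gt_at_top[of 0] by eventually_elim (rule le)
    qed
  qed
  have di: "set_integrable lborel {0<..} (\<lambda>t. \<bar>g n X t - h t\<bar>)" for n X
    by (intro set_integrable_abs set_integral_diff gi hi)
  note FI = set_integral_bern_exp[OF finite_all_edges di, folded F_def]
  have lim: "(\<lambda>n. LBINT t:{0<..}. F n t) \<longlonglongrightarrow> (LBINT t:({0<..} :: real set). (0 :: real))"
    unfolding set_lebesgue_integral_def
  proof (rule integral_dominated_convergence)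
    show "integrable lborel (\<lambda>t. indicator {0<..} t *\<^sub>R D t)"
      using Di unfolding set_integrable_def .
    show "(\<lambda>t. indicator {0<..} t *\<^sub>R F n t) \<in> borel_measurable lborel" for n
      using FI(1)[of n] unfolding set_integrable_def F_def by (rule borel_measurable_integrable)
    show "AE t in lborel. (\<lambda>n. indicator {0<..} t *\<^sub>R F n t) \<longlonglongrightarrow> indicator {0<..} t *\<^sub>R 0"
      by (intro AE_I2) (auto simp: indicator_def intro: Flim)
    show "AE t in lborel. norm (indicator {0<..} t *\<^sub>R F n t) \<le> indicator {0<..} t *\<^sub>R D t" for n
      by (intro AE_I2) (auto simp: indicator_def intro: FD)
  qed simp
  then have lim': "(\<lambda>n. 2 / pi * (LBINT t:{0<..}. F n t)) \<longlonglongrightarrow> 0"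
    by (intro tendsto_mult_right_zero) (simp add: set_lebesgue_integral_def)
  have le: "bern_exp (all_edges n) p (\<lambda>X. \<bar>mat_energy n (wigner p X) / (n * sqrt n) - 8 / (3 * pi) * sqrt ?v\<bar>)
      \<le> 2 / pi * (LBINT t:{0<..}. F n t)" if n: "n > 0" for n
  proof -
    have "\<bar>mat_energy n (wigner p X) / (n * sqrt n) - 8 / (3 * pi) * sqrt ?v\<bar>
      \<le> 2 / pi * (LBINT t:{0<..}. \<bar>g n X t - h t\<bar>)" for X
    proof -
      have "mat_energy n (?M n X) = mat_energy n (wigner p X) / sqrt n"
        using mat_energy_scale[of n "wigner p X" "1 / sqrt n"] by (simp add: wigner_sym)
      then have "mat_energy n (wigner p X) / (n * sqrt n) = (\<Sum>k<n. \<bar>l n X k\<bar>) / n"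
        using mat_energy_eigen_decomp[OF dec[of n X]] by (simp add: field_simps)
      also have "\<dots> = 2 / pi * (LBINT t:{0<..}. g n X t)" unfolding gI by simp
      finally have "mat_energy n (wigner p X) / (n * sqrt n) - 8 / (3 * pi) * sqrt ?v
        = 2 / pi * ((LBINT t:{0<..}. g n X t) - (LBINT t:{0<..}. h t))"
        unfolding hi by (simp add: algebra_simps)
      also have "\<dots> = 2 / pi * (LBINT t:{0<..}. g n X t - h t)"
        using gi hi by (simp add: set_integral_diff)
      finally have eq: "mat_energy n (wigner p X) / (n * sqrt n) - 8 / (3 * pi) * sqrt ?v
        = 2 / pi * (LBINT t:{0<..}. g n X t - h t)" .
      have "\<bar>LBINT t:{0<..}. g n X t - h t\<bar> \<le> (LBINT t:{0<..}. \<bar>g n X t - h t\<bar>)"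
        unfolding set_lebesgue_integral_def
        by (rule order_trans[OF integral_abs_bound]) (simp add: abs_mult)
      then have "2 / pi * \<bar>LBINT t:{0<..}. g n X t - h t\<bar> \<le> 2 / pi * (LBINT t:{0<..}. \<bar>g n X t - h t\<bar>)"
        by (intro mult_left_mono) auto
      then show ?thesis unfolding eq by (simp add: abs_mult)
    qed
    then have "bern_exp (all_edges n) p (\<lambda>X. \<bar>mat_energy n (wigner p X) / (n * sqrt n) - 8 / (3 * pi) * sqrt ?v\<bar>)
      \<le> bern_exp (all_edges n) p (\<lambda>X. 2 / pi * (LBINT t:{0<..}. \<bar>g n X t - h t\<bar>))"
      by (intro integral_mono) auto
    also have "\<dots> = 2 / pi * (LBINT t:{0<..}. F n t)"
      using FI(2)[of n] unfolding F_def by simp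
    finally show ?thesis .
  qed
  show ?thesis
  proof (rule tendsto_sandwich[OF _ _ tendsto_const lim'])
    show "\<forall>\<^sub>F n in sequentially. 0 \<le> bern_exp (all_edges n) p (\<lambda>X. \<bar>mat_energy n (wigner p X) / (n * sqrt n) - 8 / (3 * pi) * sqrt ?v\<bar>)"
      by (intro always_eventually allI Bochner_Integration.integral_nonneg) auto
    show "\<forall>\<^sub>F n in sequentially. bern_exp (all_edges n) p (\<lambda>X. \<bar>mat_energy n (wigner p X) / (n * sqrt n) - 8 / (3 * pi) * sqrt ?v\<bar>)
      \<le> 2 / pi * (LBINT t:{0<..}. F n t)"
      using eventually_gt_at_top[of 0] by eventually_elim (rule le)
  qed
qed

section \<open>Degrees and distances in the random graph\<close>

definition edges_of :: "nat \<Rightarrow> (nat set \<Rightarrow> bool) \<Rightarrow> nat set set" where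
  "edges_of n X = {e \<in> all_edges n. X e}"

definition row_sum :: "nat \<Rightarrow> real \<Rightarrow> (nat set \<Rightarrow> bool) \<Rightarrow> nat \<Rightarrow> real" where
  "row_sum n p X i = (\<Sum>j<n. wigner p X i j)"

lemma edges_of_iff: "i < n \<Longrightarrow> {i, j} \<in> edges_of n X \<longleftrightarrow> j < n \<and> i \<noteq> j \<and> X {i, j}"
  by (auto simp: edges_of_def all_edges_def card_2_iff doubleton_eq_iff)

lemma degree_eq:
  assumes i: "i < n"
  shows "real (degree_of (edges_of n X) i) = n * p + (row_sum n p X i - p)"
proof -
  have "{j. {i, j} \<in> edges_of n X} = {j \<in> {..<n}. i \<noteq> j \<and> X {i, j}}"
    using edges_of_iff[OF i] by auto
  then have "real (degree_of (edges_of n X) i) = (\<Sum>j<n. of_bool (i \<noteq> j \<and> X {i, j}))"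
    by (simp add: degree_of_def sum.If_cases of_bool_def Int_def)
  also have "\<dots> = (\<Sum>j<n. wigner p X i j + p - (if j = i then p else 0))"
    by (intro sum.cong refl) (auto simp: wigner_def)
  also have "\<dots> = n * p + (row_sum n p X i - p)"
    using i by (simp add: sum.distrib sum_subtractf row_sum_def)
  finally show ?thesis .
qed

lemma degree_le:
  assumes i: "i < n"
  shows "degree_of (edges_of n X) i \<le> n"
proof -
  have "{j. {i, j} \<in> edges_of n X} \<subseteq> {..<n}" using edges_of_iff[OF i] by auto
  then have "card {j. {i, j} \<in> edges_of n X} \<le> card {..<n}" by (intro card_mono) auto
  then show ?thesis by (simp add: degree_of_def)
qed

text \<open>
  The row sum is the deviation of a degree from its mean. It has mean zero, and only the edges at
  \<open>i\<close>, each with difference one, contribute to its variance.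
\<close>

lemma row_sum_second_moment:
  assumes p: "0 < p" "p < 1" and i: "i < n"
  shows "bern_exp (all_edges n) p (\<lambda>X. (row_sum n p X i)\<^sup>2) \<le> n"
proof -
  have p': "0 \<le> p" "p \<le> 1" using p by auto
  have mean: "bern_exp (all_edges n) p (\<lambda>X. wigner p X i j) = 0" if "j < n" for j
  proof (cases "i = j")
    case False
    then show ?thesis
      using expectation_bern_by_parts[OF p' finite_all_edges edge_mem[OF i that False], of "\<lambda>_. 1 :: real"]
      by (simp add: wigner_def)
  qed (simp add: wigner_def)
  have 0: "bern_exp (all_edges n) p (\<lambda>X. row_sum n p X i) = 0"
    unfolding row_sum_def by (subst Bochner_Integration.integral_sum) (auto simp: mean)
  let ?c = "\<lambda>e. of_bool (i \<in> e) :: real"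
  have flip: "\<bar>row_sum n p (X(e := True)) i - row_sum n p (X(e := False)) i\<bar> \<le> ?c e"
    if e: "e \<in> all_edges n" for X e
  proof -
    obtain a b where ab: "a < n" "b < n" "a \<noteq> b" "e = {a, b}" using e by (rule all_edgesE)
    have "row_sum n p (X(e := True)) i - row_sum n p (X(e := False)) i =
        (\<Sum>j<n. of_bool ((i, j) \<in> {(a, b), (b, a)}))"
      unfolding row_sum_def ab(4) sum_subtractf[symmetric] wigner_flip[OF ab(3)] ..
    also have "\<dots> = (\<Sum>j<n. (if j = b then of_bool (i = a) else 0) + (if j = a then of_bool (i = b) else 0))"
      using ab(3) by (intro sum.cong) auto
    also have "\<dots> = of_bool (i = a) + of_bool (i = b)" using ab by (simp add: sum.distrib)
    finally show ?thesis using ab by auto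
  qed
  have "bern_exp (all_edges n) p (\<lambda>X. (row_sum n p X i)\<^sup>2) \<le> p * (1 - p) * (\<Sum>e\<in>all_edges n. (?c e)\<^sup>2)"
  proof -
    have "bern_exp (all_edges n) p (\<lambda>X. (row_sum n p X i - bern_exp (all_edges n) p (\<lambda>X. row_sum n p X i))\<^sup>2)
      \<le> p * (1 - p) * (\<Sum>e\<in>all_edges n. (?c e)\<^sup>2)"
      by (rule variance_bern_bounded_differences[OF p' finite_all_edges flip])
    then show ?thesis unfolding 0 by simp
  qed
  also have "(\<Sum>e\<in>all_edges n. (?c e)\<^sup>2) = card {e \<in> all_edges n. i \<in> e}"
  proof -
    have "(\<Sum>e\<in>all_edges n. (?c e)\<^sup>2) = (\<Sum>e\<in>all_edges n. if i \<in> e then 1 else 0)"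
      by (intro sum.cong) auto
    then show ?thesis by (simp add: sum.If_cases Int_def)
  qed
  also have "p * (1 - p) * card {e \<in> all_edges n. i \<in> e} \<le> 1 * real (card {e \<in> all_edges n. i \<in> e})"
    using p by (intro mult_right_mono) (auto simp: mult_le_one)
  also have "{e \<in> all_edges n. i \<in> e} \<subseteq> (\<lambda>j. {i, j}) ` {..<n}"
    by (auto elim!: all_edgesE)
  then have "card {e \<in> all_edges n. i \<in> e} \<le> n"
    using card_mono[of "(\<lambda>j. {i, j}) ` {..<n}"] card_image_le[of "{..<n}" "\<lambda>j. {i, j}"]
    by (metis (no_types, lifting) card_lessThan dual_order.trans finite_imageI finite_lessThan)
  then have "1 * real (card {e \<in> all_edges n. i \<in> e}) \<le> n" by simp
  finally show ?thesis .
qed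

definition common_neighbours :: "nat \<Rightarrow> (nat set \<Rightarrow> bool) \<Rightarrow> bool" where
  "common_neighbours n X \<longleftrightarrow>
    (\<forall>i<n. \<forall>j<n. i \<noteq> j \<longrightarrow> (\<exists>k\<in>{..<n} - {i, j}. X {i, k} \<and> X {j, k}))"

lemma dist_eq:
  assumes good: "common_neighbours n X" and ij: "i < n" "j < n"
  shows "graph_dist (edges_of n X) i j = (if i = j then 0 else if X {i, j} then 1 else 2)"
proof -
  let ?A = "adj_rel (edges_of n X)"
  have A: "(a, b) \<in> ?A \<longleftrightarrow> b < n \<and> a \<noteq> b \<and> X {a, b}" if "a < n" for a b
    using edges_of_iff[OF that] by (simp add: adj_rel_def)
  define m :: nat where "m = (if i = j then 0 else if X {i, j} then 1 else 2)"
  have pow: "(i, j) \<in> ?A ^^ m"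
  proof (cases "i = j \<or> X {i, j}")
    case True
    then show ?thesis using ij by (auto simp: m_def A)
  next
    case False
    then obtain k where k: "k < n" "k \<noteq> i" "k \<noteq> j" "X {i, k}" "X {j, k}"
      using good ij unfolding common_neighbours_def by blast
    have "(i, k) \<in> ?A" "(k, j) \<in> ?A" using k ij by (auto simp: A insert_commute)
    then show ?thesis using False by (auto simp: m_def numeral_2_eq_2)
  qed
  have least: "m \<le> k" if "(i, j) \<in> ?A ^^ k" for k
  proof (rule ccontr)
    assume "\<not> m \<le> k"
    then have "k = 0 \<and> i \<noteq> j \<or> k = 1 \<and> i \<noteq> j \<and> \<not> X {i, j}"
      by (auto simp: m_def split: if_splits)
    then show False using that ij by (auto simp: A)
  qed
  have "(LEAST k. (i, j) \<in> ?A ^^ k) = m" using pow least by (rule Least_equality)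
  moreover have "(i, j) \<in> ?A\<^sup>*" using pow by (rule relpow_imp_rtrancl)
  ultimately show ?thesis by (simp add: graph_dist_def m_def)
qed

text \<open>
  The product indicates that no vertex of \<open>K\<close> is a common neighbour of \<open>i\<close> and \<open>j\<close>. Resampling
  the two edges at one vertex \<open>k\<close> of \<open>K\<close> splits off a factor \<open>1 - p\<^sup>2\<close>, since they do not
  occur in the other factors.
\<close>

lemma expected_no_common_neighbour:
  assumes p: "0 < p" "p < 1" and ij: "i < n" "j < n" "i \<noteq> j"
    and K: "K \<subseteq> {..<n} - {i, j}"
  shows "bern_exp (all_edges n) p (\<lambda>X. \<Prod>k\<in>K. 1 - of_bool (X {i, k} \<and> X {j, k})) = (1 - p\<^sup>2) ^ card K"
proof -
  have p': "0 \<le> p" "p \<le> 1" using p by auto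
  have "finite K" using K finite_subset by blast
  then show ?thesis using K
  proof (induction K rule: finite_induct)
    case empty
    then show ?case by simp
  next
    case (insert k K)
    let ?g = "\<lambda>X :: nat set \<Rightarrow> bool. \<Prod>k\<in>K. 1 - of_bool (X {i, k} \<and> X {j, k}) :: real"
    let ?e = "{i, k}" and ?e' = "{j, k}"
    have k: "k < n" "k \<noteq> i" "k \<noteq> j" using insert.prems by auto
    have mem: "?e \<in> all_edges n" "?e' \<in> all_edges n" using k ij by (auto intro: edge_mem)
    have ne: "{i, k'} \<noteq> ?e" "{i, k'} \<noteq> ?e'" "{j, k'} \<noteq> ?e" "{j, k'} \<noteq> ?e'" if "k' \<in> K" for k'
      using that insert.hyps insert.prems k ij by (auto simp: doubleton_eq_iff)
    have ge: "?g (X(?e := b)) = ?g X" and ge': "?g (X(?e' := b)) = ?g X" for X b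
      by (rule prod.cong; simp add: ne)+
    have ee': "?e' \<noteq> ?e" using ij by (auto simp: doubleton_eq_iff)
    note resample = expectation_bern_resample[OF p' finite_all_edges]
    have 1: "bern_exp (all_edges n) p (\<lambda>X. (1 - of_bool (X ?e')) * ?g X) = (1 - p) * bern_exp (all_edges n) p ?g"
      by (rule trans[OF resample[OF mem(2)]]) (simp only: ge' fun_upd_same, simp)
    have "bern_exp (all_edges n) p (\<lambda>X. \<Prod>k\<in>insert k K. 1 - of_bool (X {i, k} \<and> X {j, k}))
       = bern_exp (all_edges n) p (\<lambda>X. (1 - of_bool (X ?e \<and> X ?e')) * ?g X)"
      using insert.hyps by simp
    also have "\<dots> = bern_exp (all_edges n) p (\<lambda>X. p * ((1 - of_bool (X ?e')) * ?g X) + (1 - p) * ?g X)"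
      by (rule trans[OF resample[OF mem(1)]]) (simp only: ge fun_upd_same fun_upd_other[OF ee'], simp)
    also have "\<dots> = p * ((1 - p) * bern_exp (all_edges n) p ?g) + (1 - p) * bern_exp (all_edges n) p ?g"
      by (simp add: 1)
    also have "\<dots> = (1 - p\<^sup>2) * bern_exp (all_edges n) p ?g"
      by (simp add: algebra_simps power2_eq_square)
    finally show ?case using insert by simp
  qed
qed

lemma prob_common_neighbours:
  assumes p: "0 < p" "p < 1"
  shows "bern_exp (all_edges n) p (\<lambda>X. of_bool (\<not> common_neighbours n X)) \<le> real (n\<^sup>2) * (1 - p\<^sup>2) ^ (n - 2)"
proof -
  let ?f = "\<lambda>i j X. \<Prod>k\<in>{..<n} - {i, j}. 1 - of_bool (X {i, k} \<and> X {j, k}) :: real"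
  have f0: "0 \<le> ?f i j X" for i j X by (intro prod_nonneg) auto
  have "bern_exp (all_edges n) p (\<lambda>X. of_bool (\<not> common_neighbours n X))
     \<le> bern_exp (all_edges n) p (\<lambda>X. \<Sum>i<n. \<Sum>j<n. if i = j then 0 else ?f i j X)"
  proof (rule integral_mono)
    fix X
    show "of_bool (\<not> common_neighbours n X) \<le> (\<Sum>i<n. \<Sum>j<n. if i = j then 0 else ?f i j X)"
    proof (cases "common_neighbours n X")
      case True
      then show ?thesis using f0 by (auto intro!: sum_nonneg)
    next
      case False
      then obtain i j where ij: "i < n" "j < n" "i \<noteq> j"
        and no: "\<forall>k\<in>{..<n} - {i, j}. \<not> (X {i, k} \<and> X {j, k})"
        unfolding common_neighbours_def by blast
      have "?f i j X = 1" using no by (intro prod.neutral) auto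
      then have "1 = (if i = j then 0 else ?f i j X)" using ij(3) by simp
      also have "\<dots> \<le> (\<Sum>j<n. if i = j then 0 else ?f i j X)"
        using ij f0 by (intro member_le_sum[of j "{..<n}"]) auto
      also have "\<dots> \<le> (\<Sum>i<n. \<Sum>j<n. if i = j then 0 else ?f i j X)"
        using ij f0 by (intro member_le_sum[of i "{..<n}"]) (auto intro!: sum_nonneg)
      finally show ?thesis using False by simp
    qed
  qed auto
  also have "\<dots> = (\<Sum>i<n. \<Sum>j<n. bern_exp (all_edges n) p (\<lambda>X. if i = j then 0 else ?f i j X))"
    by (simp add: Bochner_Integration.integral_sum)
  also have "\<dots> \<le> (\<Sum>i<n. \<Sum>j<n. (1 - p\<^sup>2) ^ (n - 2))"
  proof (intro sum_mono)
    fix i j assume ij: "i \<in> {..<n}" "j \<in> {..<n}"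
    have "p\<^sup>2 \<le> 1" using p by (simp add: power_le_one)
    then show "bern_exp (all_edges n) p (\<lambda>X. if i = j then 0 else ?f i j X) \<le> (1 - p\<^sup>2) ^ (n - 2)"
      using ij expected_no_common_neighbour[OF p, of i n j "{..<n} - {i, j}"]
      by (cases "i = j") (auto simp: card_Diff_subset numeral_2_eq_2)
  qed
  also have "\<dots> = real (n\<^sup>2) * (1 - p\<^sup>2) ^ (n - 2)" by (simp add: power2_eq_square)
  finally show ?thesis .
qed

section \<open>The energy of the Gutman matrix\<close>

text \<open>
  The first summand comes from the rank one and the diagonal part. The second one bounds the
  Frobenius part; the geometric mean there is replaced by an arithmetic mean, with weights balanced
  at the typical size \<open>n\<^sup>2\<close> of the sum of squares, so that expectations can be taken termwise.
\<close>

definition gutman_error :: "nat \<Rightarrow> real \<Rightarrow> (nat set \<Rightarrow> bool) \<Rightarrow> real" where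
  "gutman_error n p X = 4 * real n ^ 3 +
    (real n)\<^sup>2 * (8 * ((\<Sum>i<n. (row_sum n p X i)\<^sup>2) + n) / n + n) / 2"

lemma gutman_error_nonneg: "0 \<le> gutman_error n p X"
  unfolding gutman_error_def by (intro add_nonneg_nonneg divide_nonneg_nonneg mult_nonneg_nonneg sum_nonneg) auto

lemma expected_gutman_error:
  assumes p: "0 < p" "p < 1" and n: "0 < n"
  shows "bern_exp (all_edges n) p (gutman_error n p) \<le> 13 * real n ^ 3"
proof -
  let ?m = "\<lambda>i. bern_exp (all_edges n) p (\<lambda>X. (row_sum n p X i)\<^sup>2)"
  have "bern_exp (all_edges n) p (gutman_error n p) =
    4 * real n ^ 3 + (real n)\<^sup>2 * (8 * ((\<Sum>i<n. ?m i) + n) / n + n) / 2"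
    unfolding gutman_error_def by (simp add: Bochner_Integration.integral_sum)
  also have "\<dots> \<le> 4 * real n ^ 3 + (real n)\<^sup>2 * (8 * ((\<Sum>i<n. real n) + n) / n + n) / 2"
    using row_sum_second_moment[OF p, of _ n]
    by (intro add_mono divide_right_mono mult_left_mono sum_mono order_refl) auto
  also have "(\<Sum>i<n. real n) = real n * n" by simp
  also have "8 * (real n * n + n) / n = 8 * (real n + 1)" using n by (simp add: field_simps)
  also have "8 * (real n + 1) + n \<le> 18 * n" using n by simp
  then have "4 * real n ^ 3 + (real n)\<^sup>2 * (8 * (real n + 1) + n) / 2 \<le> 4 * real n ^ 3 + (real n)\<^sup>2 * (18 * n) / 2"
    by (intro add_mono divide_right_mono mult_left_mono) auto
  also have "\<dots> = 13 * real n ^ 3" by (simp add: power2_eq_square power3_eq_cube)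
  finally show ?thesis .
qed

text \<open>
  With the common neighbour property the entries are \<open>d\<^sub>i d\<^sub>j ((2 - p) - (2 - p) \<delta>\<^sub>i\<^sub>j - W\<^sub>i\<^sub>j)\<close>.
  The rank one part is \<open>(2 - p) d d\<^sup>T\<close>, and the remainder \<open>-(d\<^sub>i d\<^sub>j - (np)\<^sup>2) W\<^sub>i\<^sub>j\<close> is controlled
  entrywise by the deviations of the degrees.
\<close>

lemma gutman_energy_perturbation:
  assumes p: "0 < p" "p < 1" and n: "0 < n" and good: "common_neighbours n X"
  shows "\<bar>energy (gutman_mat n (edges_of n X)) - (n * p)\<^sup>2 * mat_energy n (wigner p X)\<bar> \<le> gutman_error n p X"
proof -
  define d where "d = (\<lambda>i. real (degree_of (edges_of n X) i))"
  define y where "y = (\<lambda>i. row_sum n p X i)"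
  let ?w = "wigner p X"
  let ?G = "\<lambda>i j. d i * d j * (if i = j then 0 else if X {i, j} then 1 else 2)"
  let ?Y = "\<lambda>i j. - ((n * p)\<^sup>2) * ?w i j"
  let ?S = "\<lambda>i j. - (d i * d j - (n * p)\<^sup>2) * ?w i j"
  have dle: "0 \<le> d i" "d i \<le> n" if "i < n" for i using degree_le[OF that] by (auto simp: d_def)
  have dy: "d i - n * p = y i - p" if "i < n" for i using degree_eq[OF that, of X p] by (simp add: d_def y_def)
  have G: "energy (gutman_mat n (edges_of n X)) = mat_energy n ?G"
  proof -
    have "gutman_mat n (edges_of n X) = mat n n (\<lambda>(i, j). ?G i j)"
      unfolding gutman_mat_def d_def
      by (rule eq_matI) (auto simp: dist_eq[OF good])
    then show ?thesis by (simp add: mat_energy_def)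
  qed
  have Y: "mat_energy n ?Y = (n * p)\<^sup>2 * mat_energy n ?w"
    using mat_energy_scale[of n ?w "- ((n * p)\<^sup>2)"] by (simp add: wigner_sym)
  have "\<bar>mat_energy n ?G - mat_energy n ?Y\<bar> \<le> \<bar>2 - p\<bar> * (\<Sum>i<n. (d i)\<^sup>2)
      + (\<Sum>i<n. \<bar>- (2 - p) * (d i)\<^sup>2\<bar>) + sqrt n * sqrt (\<Sum>i<n. \<Sum>j<n. (?S i j)\<^sup>2)"
    by (rule mat_energy_perturbation)
      (auto simp: wigner_def insert_commute algebra_simps power2_eq_square)
  also have "\<dots> \<le> 2 * real n ^ 3 + 2 * real n ^ 3 + (real n)\<^sup>2 * (8 * ((\<Sum>i<n. (y i)\<^sup>2) + n) / n + n) / 2"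
  proof (intro add_mono)
    have d2: "(d i)\<^sup>2 \<le> (real n)\<^sup>2" if "i < n" for i using dle[OF that] by (intro power_mono) auto
    have "(\<Sum>i<n. (d i)\<^sup>2) \<le> (\<Sum>i<n. (real n)\<^sup>2)" using d2 by (intro sum_mono) auto
    also have "\<dots> = real n ^ 3" by (simp add: power2_eq_square power3_eq_cube)
    finally have sd: "(\<Sum>i<n. (d i)\<^sup>2) \<le> real n ^ 3" .
    have c: "\<bar>2 - p\<bar> \<le> 2" using p by simp
    show 1: "\<bar>2 - p\<bar> * (\<Sum>i<n. (d i)\<^sup>2) \<le> 2 * real n ^ 3"
      by (rule mult_mono[OF c sd]) (auto intro: sum_nonneg)
    have "(\<Sum>i<n. \<bar>- (2 - p) * (d i)\<^sup>2\<bar>) = \<bar>2 - p\<bar> * (\<Sum>i<n. (d i)\<^sup>2)"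
      by (simp only: abs_mult abs_minus_cancel abs_power2 sum_distrib_left)
    then show "(\<Sum>i<n. \<bar>- (2 - p) * (d i)\<^sup>2\<bar>) \<le> 2 * real n ^ 3" using 1 by simp
    let ?s = "\<Sum>i<n. (y i)\<^sup>2"
    have "(?S i j)\<^sup>2 \<le> 4 * (real n)\<^sup>2 * ((y i)\<^sup>2 + (y j)\<^sup>2 + 2)" if ij: "i < n" "j < n" for i j
    proof -
      have w: "(?w i j)\<^sup>2 \<le> 1" using p by (auto simp: wigner_def abs_square_le_1)
      have S: "(?S i j)\<^sup>2 = (d i * d j - (n * p)\<^sup>2)\<^sup>2 * (?w i j)\<^sup>2"
        by (simp only: power_mult_distrib power2_minus)
      have "(?S i j)\<^sup>2 \<le> (d i * d j - (n * p)\<^sup>2)\<^sup>2 * 1"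
        unfolding S by (intro mult_left_mono w) auto
      moreover have "d i * d j - (n * p)\<^sup>2 = d i * (y j - p) + n * p * (y i - p)"
        using dy[OF ij(1)] dy[OF ij(2)] by (simp add: algebra_simps power2_eq_square flip: dy[OF ij(1)] dy[OF ij(2)])
      moreover have "(d i * (y j - p) + n * p * (y i - p))\<^sup>2 \<le> 4 * (real n)\<^sup>2 * ((y i)\<^sup>2 + (y j)\<^sup>2 + 2)"
      proof -
        have "(d i * (y j - p) + n * p * (y i - p))\<^sup>2 \<le> 2 * ((d i)\<^sup>2 * (y j - p)\<^sup>2) + 2 * ((n * p)\<^sup>2 * (y i - p)\<^sup>2)"
        proof -
          have "(a + b)\<^sup>2 \<le> 2 * a\<^sup>2 + 2 * b\<^sup>2" for a b :: real
            using sum_squares_bound[of a b] by (simp add: power2_sum)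
          from this[of "d i * (y j - p)" "n * p * (y i - p)"] show ?thesis
            by (simp only: power_mult_distrib mult.assoc)
        qed
        also have "\<dots> \<le> 2 * ((real n)\<^sup>2 * (2 * (y j)\<^sup>2 + 2)) + 2 * ((real n)\<^sup>2 * (2 * (y i)\<^sup>2 + 2))"
        proof -
          have sq: "(z - p)\<^sup>2 \<le> 2 * z\<^sup>2 + 2" for z
          proof -
            have "p\<^sup>2 \<le> 1" using p by (simp add: power_le_one)
            moreover have "(z - p)\<^sup>2 + (z + p)\<^sup>2 = 2 * z\<^sup>2 + 2 * p\<^sup>2" by (simp add: power2_eq_square algebra_simps)
            moreover have "0 \<le> (z + p)\<^sup>2" by simp
            ultimately show ?thesis by linarith
          qed
          have np: "(n * p)\<^sup>2 \<le> (real n)\<^sup>2" using p by (intro power_mono) (auto simp: mult_left_le)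
          show ?thesis using d2[OF ij(1)] np sq by (intro add_mono mult_left_mono mult_mono) auto
        qed
        also have "\<dots> = 4 * (real n)\<^sup>2 * ((y i)\<^sup>2 + (y j)\<^sup>2 + 2)" by (simp add: algebra_simps)
        finally show ?thesis .
      qed
      ultimately show ?thesis by simp
    qed
    then have "(\<Sum>i<n. \<Sum>j<n. (?S i j)\<^sup>2) \<le> (\<Sum>i<n. \<Sum>j<n. 4 * (real n)\<^sup>2 * ((y i)\<^sup>2 + (y j)\<^sup>2 + 2))"
      by (intro sum_mono) auto
    also have "\<dots> = 4 * (real n)\<^sup>2 * (\<Sum>i<n. \<Sum>j<n. (y i)\<^sup>2 + (y j)\<^sup>2 + 2)"
      by (simp only: sum_distrib_left)
    also have "(\<Sum>i<n. \<Sum>j<n. (y i)\<^sup>2 + (y j)\<^sup>2 + 2) = 2 * real n * (?s + n)"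
      by (simp add: sum.distrib flip: sum_distrib_left) (simp add: algebra_simps)
    also have "4 * (real n)\<^sup>2 * (2 * real n * (?s + n)) = 8 * real n ^ 3 * (?s + n)"
      by (simp add: power2_eq_square power3_eq_cube)
    finally have "sqrt n * sqrt (\<Sum>i<n. \<Sum>j<n. (?S i j)\<^sup>2) \<le> sqrt n * sqrt (8 * real n ^ 3 * (?s + n))"
      by (intro mult_left_mono) auto
    also have "\<dots> = sqrt (((real n)\<^sup>2)\<^sup>2 * (8 * (?s + n)))"
      by (simp add: real_sqrt_mult[symmetric] power2_eq_square power3_eq_cube algebra_simps)
    also have "\<dots> = (real n)\<^sup>2 * sqrt (8 * (?s + n))"
      by (simp only: real_sqrt_mult real_sqrt_abs abs_power2)
    also have "\<dots> \<le> (real n)\<^sup>2 * ((8 * (?s + n) / n + n) / 2)"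
    proof (rule mult_left_mono)
      have s0: "0 \<le> ?s" by (intro sum_nonneg) auto
      have "sqrt (8 * (?s + n)) = sqrt (8 * (?s + n) / n * n)" using n by simp
      also have "\<dots> \<le> (8 * (?s + n) / n + n) / 2"
        using s0 by (intro arith_geo_mean_sqrt) auto
      finally show "sqrt (8 * (?s + n)) \<le> (8 * (?s + n) / n + n) / 2" .
    qed auto
    finally show "sqrt n * sqrt (\<Sum>i<n. \<Sum>j<n. (?S i j)\<^sup>2) \<le> (real n)\<^sup>2 * (8 * (?s + n) / n + n) / 2"
      by simp
  qed
  also have "\<dots> = gutman_error n p X" by (simp add: gutman_error_def y_def)
  finally show ?thesis unfolding G Y .
qed

text \<open>
  On the common neighbour event the deviation is at most \<open>Z\<close>, whose expectation tends to zero.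
  Markov's inequality at the level of the square root of a bound on that expectation gives a
  deterministic null sequence. The summand \<open>1/(n+1)\<close> only keeps this level positive.
\<close>

theorem corollary3p7:
  fixes p :: real
  assumes "0 < p" and "p < 1"
  shows "\<exists>\<epsilon> :: nat \<Rightarrow> real. \<epsilon> \<longlonglongrightarrow> 0 \<and>
    (\<lambda>n. measure_pmf.prob (gnp n p)
        {E. \<exists>r. \<bar>r\<bar> \<le> \<epsilon> n \<and>
          energy (gutman_mat n E) =
            (8 / (3 * pi) * p\<^sup>2 * sqrt (p * (1 - p)) + r) * real n powr (7 / 2)})
      \<longlonglongrightarrow> 1"
proof -
  note p = assms
  define C where "C = 8 / (3 * pi) * sqrt (p * (1 - p))"
  define a where "a = (\<lambda>n. bern_exp (all_edges n) p (\<lambda>X. \<bar>mat_energy n (wigner p X) / (n * sqrt n) - C\<bar>))"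
  define Z where "Z = (\<lambda>n X. gutman_error n p X / (real n ^ 3 * sqrt n)
      + \<bar>mat_energy n (wigner p X) / (n * sqrt n) - C\<bar>)"
  define \<epsilon> where "\<epsilon> = (\<lambda>n. sqrt (13 / sqrt n + a n + 1 / real (Suc n)))"
  define A where "A = (\<lambda>n. {E. \<exists>r. \<bar>r\<bar> \<le> \<epsilon> n \<and> energy (gutman_mat n E) =
            (8 / (3 * pi) * p\<^sup>2 * sqrt (p * (1 - p)) + r) * real n powr (7 / 2)})"
  have a: "a \<longlonglongrightarrow> 0" unfolding a_def C_def by (rule wigner_energy_limit[OF p])
  have a0: "0 \<le> a n" for n unfolding a_def by (intro Bochner_Integration.integral_nonneg) auto
  have "(\<lambda>n. sqrt (13 / sqrt n + a n + 1 / real (Suc n))) \<longlonglongrightarrow> sqrt (0 + 0 + 0)"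
    by (intro tendsto_intros a; real_asymp)
  then have \<epsilon>: "\<epsilon> \<longlonglongrightarrow> 0" by (simp add: \<epsilon>_def)
  have \<epsilon>0: "0 < \<epsilon> n" for n unfolding \<epsilon>_def using a0[of n] by (simp add: add_nonneg_pos)
  have Z0: "0 \<le> Z n X" for n X unfolding Z_def using gutman_error_nonneg[of n p X] by simp
  have EZ: "bern_exp (all_edges n) p (Z n) \<le> (\<epsilon> n)\<^sup>2" if n: "0 < n" for n
  proof -
    have "bern_exp (all_edges n) p (Z n) = bern_exp (all_edges n) p (gutman_error n p) / (real n ^ 3 * sqrt n) + a n"
      unfolding Z_def a_def by simp
    also have "bern_exp (all_edges n) p (gutman_error n p) / (real n ^ 3 * sqrt n) \<le> 13 * real n ^ 3 / (real n ^ 3 * sqrt n)"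
      by (intro divide_right_mono expected_gutman_error p n) auto
    also have "\<dots> = 13 / sqrt n" using n by simp
    finally have "bern_exp (all_edges n) p (Z n) \<le> 13 / sqrt n + a n" by simp
    also have "\<dots> \<le> 13 / sqrt n + a n + 1 / real (Suc n)" by simp
    also have "\<dots> = (\<epsilon> n)\<^sup>2" unfolding \<epsilon>_def using a0[of n] by simp
    finally show ?thesis .
  qed
  have mem: "edges_of n X \<in> A n" if n: "0 < n" and good: "common_neighbours n X" and le: "Z n X \<le> \<epsilon> n" for n X
  proof -
    let ?N = "real n ^ 3 * sqrt n"
    let ?e = "energy (gutman_mat n (edges_of n X))" and ?w = "mat_energy n (wigner p X)"
    have N: "?N > 0" using n by simp
    have Np: "real n powr (7 / 2) = ?N"
    proof -
      have "real n powr (7 / 2) = real n powr (3 + 1 / 2)" by simp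
      also have "\<dots> = real n powr 3 * real n powr (1 / 2)" by (rule powr_add)
      finally show ?thesis using n by (simp add: powr_half_sqrt)
    qed
    define r where "r = ?e / ?N - p\<^sup>2 * C"
    have "r = (?e - (n * p)\<^sup>2 * ?w) / ?N + p\<^sup>2 * (?w / (n * sqrt n) - C)"
      unfolding r_def using n by (simp add: field_simps power2_eq_square power3_eq_cube)
    then have "\<bar>r\<bar> \<le> \<bar>?e - (n * p)\<^sup>2 * ?w\<bar> / ?N + p\<^sup>2 * \<bar>?w / (n * sqrt n) - C\<bar>"
      using N by (metis abs_divide abs_mult abs_of_pos abs_power2 abs_triangle_ineq)
    also have "\<dots> \<le> gutman_error n p X / ?N + 1 * \<bar>?w / (n * sqrt n) - C\<bar>"
      using p N gutman_energy_perturbation[OF p n good]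
      by (intro add_mono divide_right_mono mult_right_mono) (auto simp: power_le_one)
    also have "\<dots> \<le> \<epsilon> n" using le by (simp add: Z_def)
    finally have "\<bar>r\<bar> \<le> \<epsilon> n" .
    moreover have "?e = (8 / (3 * pi) * p\<^sup>2 * sqrt (p * (1 - p)) + r) * real n powr (7 / 2)"
    proof -
      have "8 / (3 * pi) * p\<^sup>2 * sqrt (p * (1 - p)) + r = ?e / ?N" by (simp add: r_def C_def)
      then show ?thesis unfolding Np using n N by simp
    qed
    ultimately show ?thesis unfolding A_def by blast
  qed
  have lower: "1 - real (n\<^sup>2) * (1 - p\<^sup>2) ^ (n - 2) - \<epsilon> n \<le> measure_pmf.prob (gnp n p) (A n)" if n: "0 < n" for n
  proof -
    let ?P = "bern_prod (all_edges n) p"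
    have "1 - indicator (edges_of n -` A n) X \<le> of_bool (\<not> common_neighbours n X) + Z n X / \<epsilon> n" for X :: "nat set \<Rightarrow> bool"
    proof (cases "edges_of n X \<in> A n \<or> \<not> common_neighbours n X")
      case True
      have "0 \<le> Z n X / \<epsilon> n" using Z0[of n X] \<epsilon>0[of n] by simp
      moreover have "1 - indicator (edges_of n -` A n) X \<le> (of_bool (\<not> common_neighbours n X) :: real)"
        using True by (auto simp: indicator_def)
      ultimately show ?thesis by linarith
    next
      case False
      then have "\<epsilon> n \<le> Z n X" using mem[OF n] by force
      then have "1 \<le> Z n X / \<epsilon> n" using \<epsilon>0[of n] by simp
      then show ?thesis using False by (simp add: indicator_def)
    qed
    then have "bern_exp (all_edges n) p (\<lambda>X. 1 - indicator (edges_of n -` A n) X)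
      \<le> bern_exp (all_edges n) p (\<lambda>X. of_bool (\<not> common_neighbours n X) + Z n X / \<epsilon> n)"
      by (intro integral_mono) auto
    also have "\<dots> = bern_exp (all_edges n) p (\<lambda>X. of_bool (\<not> common_neighbours n X)) + bern_exp (all_edges n) p (Z n) / \<epsilon> n"
      by simp
    also have "\<dots> \<le> real (n\<^sup>2) * (1 - p\<^sup>2) ^ (n - 2) + (\<epsilon> n)\<^sup>2 / \<epsilon> n"
      using \<epsilon>0[of n] by (intro add_mono prob_common_neighbours p divide_right_mono EZ n) auto
    also have "(\<epsilon> n)\<^sup>2 / \<epsilon> n = \<epsilon> n" using \<epsilon>0[of n] by (simp add: power2_eq_square)
    also have "bern_exp (all_edges n) p (\<lambda>X. 1 - indicator (edges_of n -` A n) X) =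
        1 - measure_pmf.prob ?P (edges_of n -` A n)"
      by (simp del: vimage_Collect_eq)
    also have "measure_pmf.prob ?P (edges_of n -` A n) = measure_pmf.prob (gnp n p) (A n)"
      unfolding gnp_def edges_of_def[abs_def] by (simp only: measure_map_pmf)
    finally show ?thesis by simp
  qed
  have "(\<lambda>n. measure_pmf.prob (gnp n p) (A n)) \<longlonglongrightarrow> 1"
  proof (rule tendsto_sandwich[OF _ _ _ tendsto_const])
    show "\<forall>\<^sub>F n in sequentially. 1 - real (n\<^sup>2) * (1 - p\<^sup>2) ^ (n - 2) - \<epsilon> n \<le> measure_pmf.prob (gnp n p) (A n)"
      using eventually_gt_at_top[of 0] by eventually_elim (rule lower)
    show "\<forall>\<^sub>F n in sequentially. measure_pmf.prob (gnp n p) (A n) \<le> 1" by simp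
    have "(\<lambda>n. real (n\<^sup>2) * (1 - p\<^sup>2) ^ (n - 2)) \<longlonglongrightarrow> 0"
    proof -
      define q where "q = 1 - p\<^sup>2"
      have q: "0 < q" "q < 1" using p by (auto simp: q_def power_less_one_iff abs_square_less_1)
      have "(\<lambda>n. real ((n + 2)\<^sup>2) * q ^ n) \<longlonglongrightarrow> 0" using q by real_asymp
      then have "(\<lambda>n. real ((n + 2)\<^sup>2) * q ^ (n + 2 - 2)) \<longlonglongrightarrow> 0" by simp
      then show ?thesis unfolding q_def[symmetric] by (rule LIMSEQ_offset)
    qed
    from tendsto_diff[OF tendsto_diff[OF tendsto_const[of 1] this] \<epsilon>]
    show "(\<lambda>n. 1 - real (n\<^sup>2) * (1 - p\<^sup>2) ^ (n - 2) - \<epsilon> n) \<longlonglongrightarrow> 1" by simp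
  qed
  with \<epsilon> show ?thesis unfolding A_def by blast
qed

end
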